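(* Let $(c,\kappa)\in\tilde{\mathcal{D}}\cup\mathcal{C}$. Assume that $u\in\mathcal{X}(\mathbb{R})$ is a weak solution to $\mathrm{TW}(c,\kappa)$. If there exist real numbers $a<b$ such that $|u(x)|^2=1/(2\kappa)$ for all $x\in(a,b)$, then $\kappa=1/2$.
   Context: For $z_1,z_2\in\mathbb{C}$, $\langle z_1,z_2\rangle=\operatorname{Re}(z_1\overline{z_2})$. Energy space: $\mathcal{X}(\mathbb{R})=\{v\in H^1_{\mathrm{loc}}(\mathbb{R};\mathbb{C}): 1-|v|^2\in L^2(\mathbb{R}),\ v'\in L^2(\mathbb{R})\}$ (its elements are continuous). $\mathrm{TW}(c,\kappa)$ is the equation $icu'+u''+u(1-|u|^2)+\kappa u(1-|u|^2)''=0$. A function $u\in\mathcal{X}(\mathbb{R})$ is a weak solution if for all $\phi\in C_0^\infty(\mathbb{R};\mathbb{C})$, $$\int_{\mathbb{R}}\langle icu'+u(1-|u|^2),\phi\rangle-\langle u',\phi'\rangle+2\kappa\langle u,u'\rangle\langle u,\phi\rangle'=0.$$ Parameter sets: $\tilde{\mathcal{D}}=\mathcal{D}_1\cup\mathcal{D}_3\cup\mathcal{B}_-\cup\mathcal{B}_+$ with $\mathcal{D}_1=\{0\le c<\sqrt2,\ 0<\kappa<1/2\}$, $\mathcal{D}_3=\{c>\sqrt2,\ \kappa>1/2\}$, $\mathcal{B}_-=\{c=\sqrt2,\ 0<\kappa<1/2\}$, $\mathcal{B}_+=\{c=\sqrt2,\ \kappa>1/2\}$; and $\mathcal{C}=\{c\ge0,\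 \kappa=1/2\}$. *)

theory Defs
  imports "HOL-Analysis.Analysis"
begin

text \<open>The pairing \<open>\<langle>z, w\<rangle> = Re (z * cnj w)\<close> is the library's inner product on \<^typ>\<open>complex\<close>.\<close>

lemma inner_complex_eq_Re_cnj: "z \<bullet> w = Re (z * cnj w)"
  by (simp add: inner_complex_def)

definition vderiv :: "(real \<Rightarrow> 'a::real_normed_vector) \<Rightarrow> real \<Rightarrow> 'a" where
  "vderiv f = (\<lambda>x. vector_derivative f (at x))"

text \<open>\<open>C_0^\<infinity>(\<real>; 'a)\<close>: infinitely differentiable functions with compact support.\<close>

definition test_functions :: "(real \<Rightarrow> 'a::real_normed_vector) set" where
  "test_functions =
     {\<phi>. (\<forall>n. (vderiv ^^ n) \<phi> differentiable_on UNIV) \<and> compact (closure {x. \<phi> x \<noteq> 0})}"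

definition L1_loc :: "(real \<Rightarrow> 'a::{banach, second_countable_topology}) set" where
  "L1_loc = {f. \<forall>K. compact K \<longrightarrow> set_integrable lborel K f}"

definition L2 :: "(real \<Rightarrow> 'a::{banach, second_countable_topology}) set" where
  "L2 = {f. f \<in> borel_measurable lborel \<and> integrable lborel (\<lambda>x. (norm (f x))\<^sup>2)}"

definition L2_loc :: "(real \<Rightarrow> 'a::{banach, second_countable_topology}) set" where
  "L2_loc = {f. f \<in> borel_measurable lborel \<and>
     (\<forall>K. compact K \<longrightarrow> set_integrable lborel K (\<lambda>x. (norm (f x))\<^sup>2))}"

definition has_weak_deriv ::
  "(real \<Rightarrow> 'a::{banach, second_countable_topology}) \<Rightarrow> (real \<Rightarrow> 'a) \<Rightarrow> bool" where
  "has_weak_deriv f g \<longleftrightarrow> f \<in> L1_loc \<and> g \<in> L1_loc \<and>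
     (\<forall>\<psi> :: real \<Rightarrow> real. \<psi> \<in> test_functions \<longrightarrow>
        (LINT x|lborel. vderiv \<psi> x *\<^sub>R f x) = - (LINT x|lborel. \<psi> x *\<^sub>R g x))"

text \<open>A weak derivative is unique only up to null sets. \<open>weak_deriv f\<close> selects one
  representative (and is meaningless if \<open>f\<close> has no weak derivative); below it only
  occurs under integrals and in integrability conditions.\<close>

definition weak_deriv ::
  "(real \<Rightarrow> 'a::{banach, second_countable_topology}) \<Rightarrow> real \<Rightarrow> 'a" where
  "weak_deriv f = (SOME g. has_weak_deriv f g)"

definition H1_loc :: "(real \<Rightarrow> 'a::{banach, second_countable_topology}) set" where
  "H1_loc = {f. f \<in> L2_loc \<and> (\<exists>g. has_weak_deriv f g \<and> g \<in> L2_loc)}"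

text \<open>The energy space \<open>\<X>(\<real>)\<close>. Every class in \<open>H^1_loc(\<real>)\<close> has exactly one continuous
  representative; the elements of \<open>\<X>(\<real>)\<close> are taken to be these representatives, so that
  pointwise values of \<open>v\<close> are well defined.\<close>

definition energy_space :: "(real \<Rightarrow> complex) set" where
  "energy_space = {v. v \<in> H1_loc \<and> continuous_on UNIV v \<and>
     (\<lambda>x. 1 - (cmod (v x))\<^sup>2) \<in> L2 \<and> weak_deriv v \<in> L2}"

text \<open>Weak solutions of \<open>i c u' + u'' + u (1 - |u|^2) + \<kappa> u (1 - |u|^2)'' = 0\<close>. The function
  \<open>\<langle>u, \<phi>\<rangle>\<close> is in general only weakly differentiable.\<close>

definition weak_solution_TW :: "real \<Rightarrow> real \<Rightarrow> (real \<Rightarrow> complex) \<Rightarrow> bool" where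
  "weak_solution_TW c \<kappa> u \<longleftrightarrow> u \<in> energy_space \<and>
     (\<forall>\<phi> :: real \<Rightarrow> complex. \<phi> \<in> test_functions \<longrightarrow>
        (LINT x|lborel.
            (\<i> * of_real c * weak_deriv u x + u x * of_real (1 - (cmod (u x))\<^sup>2)) \<bullet> \<phi> x
          - weak_deriv u x \<bullet> vderiv \<phi> x
          + 2 * \<kappa> * (u x \<bullet> weak_deriv u x) * weak_deriv (\<lambda>y. u y \<bullet> \<phi> y) x) = 0)"

definition params_D1 :: "(real \<times> real) set" where
  "params_D1 = {(c, \<kappa>). 0 \<le> c \<and> c < sqrt 2 \<and> 0 < \<kappa> \<and> \<kappa> < 1/2}"

definition params_D3 :: "(real \<times> real) set" where
  "params_D3 = {(c, \<kappa>). c > sqrt 2 \<and> \<kappa> > 1/2}"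

definition params_B_minus :: "(real \<times> real) set" where
  "params_B_minus = {(c, \<kappa>). c = sqrt 2 \<and> 0 < \<kappa> \<and> \<kappa> < 1/2}"

definition params_B_plus :: "(real \<times> real) set" where
  "params_B_plus = {(c, \<kappa>). c = sqrt 2 \<and> \<kappa> > 1/2}"

definition params_D_tilde :: "(real \<times> real) set" where
  "params_D_tilde = params_D1 \<union> params_D3 \<union> params_B_minus \<union> params_B_plus"

definition params_C :: "(real \<times> real) set" where
  "params_C = {(c, \<kappa>). c \<ge> 0 \<and> \<kappa> = 1/2}"

end

theory Submission
  imports Defs
begin

text \<open>The obstacle is degeneracy: \<langle>w, u\<rangle> = (1 - 2 \<kappa> |u|^2) \<langle>u,
  u'\<rangle>, and this factor vanishes precisely where |u|^2 = 1/(2 \<kappa>). On that set the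
  radial part of u' cannot be recovered from w, so the continuity of w does not make u' continuous.
  Hence no classical derivative of u is ever taken: every identity is stated almost everywhere and
  differentiated through primitives of locally integrable functions. The angular component is
  immune, since \<langle>w, \<i> u\<rangle> = \<langle>u', \<i> u\<rangle> whatever the modulus. It
  needs no polar form either, so zeros of u are harmless.

  The curve c^2 \<kappa> (2 \<kappa> + 1) = 2 runs through the corner (sqrt 2, 1/2), and its left
  side increases in c and in \<kappa>. The regions with \<kappa> \<noteq> 1/2 lie in the two
  quadrants at this corner where c and \<kappa> deviate in the same direction, and there the left
  side is strictly below or strictly above 2.\<close>

text \<open>The weak formulation says that the flux \<open>w = u' - 2 \<kappa> \<langle>u, u'\<rangle> u\<close> has a locally integrable weak
  derivative, so \<open>u\<close> and \<open>w\<close> are absolutely continuous. The product rule gives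
  \<open>\<langle>w, \<i> u\<rangle>' = - c \<langle>u, u'\<rangle>\<close>, and finite energy fixes the constant:
  \<open>\<langle>u', \<i> u\<rangle> = c (1 - |u|\<^sup>2) / 2\<close>. Where \<open>|u|\<^sup>2 = 1 / (2 \<kappa>)\<close> on an interval, this forces
  \<open>u' = \<i> \<beta> u\<close> with \<open>\<beta> = c (2 \<kappa> - 1) / 2\<close>, and the equation becomes
  \<open>c \<beta> + \<beta>\<^sup>2 = 1 - 1 / (2 \<kappa>)\<close>. If \<open>\<kappa> \<noteq> 1/2\<close>, then \<open>c\<^sup>2 \<kappa> (2 \<kappa> + 1) = 2\<close>, which no admissible
  pair of parameters satisfies.\<close>

section \<open>Test functions\<close>

text \<open>Smoothness is graded by order because closure under products is proved by induction: the
  derivative of a product is a sum of products of one order less.\<close>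

definition smooth_upto :: "nat \<Rightarrow> (real \<Rightarrow> 'a::real_normed_vector) \<Rightarrow> bool" where
  "smooth_upto n f \<longleftrightarrow> (\<forall>k<n. (vderiv ^^ k) f differentiable_on UNIV)"

lemma smooth_upto_0 [simp]: "smooth_upto 0 f"
  by (simp add: smooth_upto_def)

lemma smooth_upto_Suc:
  "smooth_upto (Suc n) f \<longleftrightarrow> f differentiable_on UNIV \<and> smooth_upto n (vderiv f)"
  by (simp add: smooth_upto_def All_less_Suc2 funpow_swap1 funpow_Suc_right del: funpow.simps)

lemma smooth_upto_mono: "smooth_upto m f" if "smooth_upto n f" "m \<le> n"
  using that by (auto simp: smooth_upto_def)

lemma smooth_iff_smooth_upto:
  "(\<forall>n. (vderiv ^^ n) f differentiable_on UNIV) \<longleftrightarrow> (\<forall>n. smooth_upto n f)"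
  by (auto simp: smooth_upto_def)

lemma has_vector_derivative_vderiv:
  "f differentiable_on UNIV \<Longrightarrow> (f has_vector_derivative vderiv f x) (at x)"
  unfolding vderiv_def by (simp add: differentiable_on_def vector_derivative_works)

lemma vderiv_eqI:
  "(\<And>x. (f has_vector_derivative f' x) (at x)) \<Longrightarrow> vderiv f = f'"
  unfolding vderiv_def by (auto intro!: ext vector_derivative_at)

lemma differentiable_on_UNIV_I:
  "(\<And>x. (f has_vector_derivative f' x) (at x)) \<Longrightarrow> f differentiable_on UNIV"
  by (auto simp: differentiable_on_def intro: differentiableI_vector)

lemma smooth_upto_add:
  "smooth_upto n f \<Longrightarrow> smooth_upto n g \<Longrightarrow> smooth_upto n (\<lambda>x. f x + g x)"
proof (induction n arbitrary: f g)
  case (Suc n)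
  then have d: "f differentiable_on UNIV" "g differentiable_on UNIV"
    by (auto simp: smooth_upto_Suc)
  have *: "((\<lambda>x. f x + g x) has_vector_derivative vderiv f x + vderiv g x) (at x)" for x
    using d by (intro has_vector_derivative_add has_vector_derivative_vderiv)
  show ?case
    using Suc by (auto simp: smooth_upto_Suc vderiv_eqI[OF *] intro: differentiable_on_UNIV_I[OF *])
qed simp

lemma has_vector_derivative_vderiv_scaleR:
  fixes f :: "real \<Rightarrow> real"
  assumes "f differentiable_on UNIV"
  shows "((\<lambda>x. f x *\<^sub>R z) has_vector_derivative vderiv f x *\<^sub>R z) (at x)"
  using has_vector_derivative_scaleR[of f "vderiv f x" x UNIV "\<lambda>_. z" 0]
    has_vector_derivative_vderiv[OF assms, of x]
  by (simp add: has_real_derivative_iff_has_vector_derivative)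

lemma smooth_upto_scaleR_left:
  fixes f :: "real \<Rightarrow> real"
  shows "smooth_upto n f \<Longrightarrow> smooth_upto n (\<lambda>x. f x *\<^sub>R z)"
proof (induction n arbitrary: f)
  case (Suc n)
  then have d: "f differentiable_on UNIV"
    by (auto simp: smooth_upto_Suc)
  note * = has_vector_derivative_vderiv_scaleR[OF d, of z]
  show ?case
    using Suc by (auto simp: smooth_upto_Suc vderiv_eqI[OF *] intro: differentiable_on_UNIV_I[OF *])
qed simp

lemma has_vector_derivative_mult_vderiv:
  fixes f g :: "real \<Rightarrow> real"
  assumes "f differentiable_on UNIV" "g differentiable_on UNIV"
  shows "((\<lambda>x. f x * g x) has_vector_derivative f x * vderiv g x + vderiv f x * g x) (at x)"
  using assms by (intro has_vector_derivative_mult has_vector_derivative_vderiv)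

lemma smooth_upto_mult:
  fixes f g :: "real \<Rightarrow> real"
  shows "smooth_upto n f \<Longrightarrow> smooth_upto n g \<Longrightarrow> smooth_upto n (\<lambda>x. f x * g x)"
proof (induction n arbitrary: f g)
  case (Suc n)
  then have d: "f differentiable_on UNIV" "g differentiable_on UNIV"
    by (auto simp: smooth_upto_Suc)
  note * = has_vector_derivative_mult_vderiv[OF d]
  \<comment> \<open>The product rule leaves \<open>f\<close> and \<open>g\<close> undifferentiated
    in one factor each, so both are needed at the lower order as well.\<close>
  have "smooth_upto n f" "smooth_upto n g"
    using Suc.prems by (simp_all add: smooth_upto_mono[of "Suc n"])
  then have "smooth_upto n (\<lambda>x. f x * vderiv g x + vderiv f x * g x)"
    using Suc by (simp add: smooth_upto_add smooth_upto_Suc)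
  then show ?case
    unfolding smooth_upto_Suc vderiv_eqI[OF *] using differentiable_on_UNIV_I[OF *] by blast
qed simp

text \<open>A closure is closed, so on the line its compactness is mere boundedness; the bound
  \<open>M\<close> is what the later cut-offs to intervals use.\<close>

lemma test_functions_iff:
  "\<phi> \<in> test_functions \<longleftrightarrow> (\<forall>n. smooth_upto n \<phi>) \<and> (\<exists>M. \<forall>x. \<bar>x\<bar> > M \<longrightarrow> \<phi> x = 0)"
proof -
  have "compact (closure {x. \<phi> x \<noteq> 0}) \<longleftrightarrow> (\<exists>M. \<forall>x. \<bar>x\<bar> > M \<longrightarrow> \<phi> x = 0)"
    by (auto simp: bounded_iff not_less[symmetric])
  then show ?thesis
    by (simp add: test_functions_def smooth_iff_smooth_upto)
qed

lemma test_functions_differentiable: "\<phi> \<in> test_functions \<Longrightarrow> \<phi> differentiable_on UNIV"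
  using smooth_upto_Suc[of 0 \<phi>] by (simp add: test_functions_iff del: One_nat_def)

lemma test_functions_continuous: "\<phi> \<in> test_functions \<Longrightarrow> continuous_on UNIV \<phi>"
  by (intro differentiable_imp_continuous_on test_functions_differentiable)

lemma vderiv_zero_outside:
  assumes "\<forall>x. \<bar>x\<bar> > M \<longrightarrow> \<phi> x = 0" and "\<bar>x\<bar> > M"
  shows "vderiv \<phi> x = 0"
proof -
  have "((\<lambda>_. 0) has_vector_derivative 0) (at x)" by simp
  then have "(\<phi> has_vector_derivative 0) (at x)"
  proof (rule has_vector_derivative_transform_within_open)
    show "open {x::real. M < \<bar>x\<bar>}"
      by (intro open_Collect_less continuous_intros)
  qed (use assms in auto)
  then show ?thesis
    by (simp add: vderiv_def vector_derivative_at)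
qed

lemma test_functions_vderiv:
  assumes "\<phi> \<in> test_functions"
  shows "vderiv \<phi> \<in> test_functions"
proof -
  obtain M where "\<forall>x. \<bar>x\<bar> > M \<longrightarrow> \<phi> x = 0"
    using assms unfolding test_functions_iff by blast
  then have "\<forall>x. \<bar>x\<bar> > M \<longrightarrow> vderiv \<phi> x = 0"
    using vderiv_zero_outside by blast
  moreover have "smooth_upto n (vderiv \<phi>)" for n
    using assms smooth_upto_Suc[of n \<phi>] unfolding test_functions_iff by blast
  ultimately show ?thesis unfolding test_functions_iff by blast
qed

lemma test_functions_add:
  assumes "\<phi> \<in> test_functions" "\<psi> \<in> test_functions"
  shows "(\<lambda>x. \<phi> x + \<psi> x) \<in> test_functions"
proof -
  obtain M N where "\<forall>x. \<bar>x\<bar> > M \<longrightarrow> \<phi> x = 0" "\<forall>x. \<bar>x\<bar> > N \<longrightarrow> \<psi> x = 0"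
    using assms unfolding test_functions_iff by blast
  then have "\<forall>x. \<bar>x\<bar> > max M N \<longrightarrow> \<phi> x + \<psi> x = 0" by simp
  then show ?thesis
    using assms unfolding test_functions_iff by (blast intro: smooth_upto_add)
qed

lemma test_functions_scaleR_left:
  fixes \<phi> :: "real \<Rightarrow> real"
  assumes "\<phi> \<in> test_functions"
  shows "(\<lambda>x. \<phi> x *\<^sub>R z) \<in> test_functions"
  using assms smooth_upto_scaleR_left[of _ \<phi> z] unfolding test_functions_iff by fastforce

text \<open>The functions \<open>p (1/y) exp (-1/y)\<close>, extended by \<open>0\<close>, are closed under differentiation;
  this gives their smoothness at \<open>0\<close>.\<close>

definition flat :: "real poly \<Rightarrow> real \<Rightarrow> real" where
  "flat p y = (if y > 0 then poly p (1 / y) * exp (- (1 / y)) else 0)"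

lemma poly_times_exp_tendsto_0: "((\<lambda>t. poly p t * exp (- t)) \<longlongrightarrow> (0::real)) at_top"
proof -
  have "((\<lambda>t. \<Sum>i\<le>degree p. coeff p i * (t ^ i / exp t)) \<longlongrightarrow> (\<Sum>i\<le>degree p. coeff p i * (0::real))) at_top"
    by (intro tendsto_intros tendsto_power_div_exp_0)
  moreover have "(\<lambda>t. \<Sum>i\<le>degree p. coeff p i * (t ^ i / exp t)) = (\<lambda>t. poly p t * exp (- t))"
    by (auto simp: poly_altdef sum_distrib_right exp_minus divide_inverse mult.assoc)
  ultimately show ?thesis by simp
qed

lemma flat_tendsto_0_right: "(flat p \<longlongrightarrow> 0) (at_right 0)"
proof -
  have "((\<lambda>y. poly p (inverse y) * exp (- inverse y)) \<longlongrightarrow> 0) (at_right 0)"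
    by (rule filterlim_compose[OF poly_times_exp_tendsto_0 filterlim_inverse_at_top_right])
  moreover have "eventually (\<lambda>y. poly p (inverse y) * exp (- inverse y) = flat p y) (at_right 0)"
    unfolding eventually_at_filter by (auto simp: flat_def divide_inverse)
  ultimately show ?thesis by (rule Lim_transform_eventually)
qed

text \<open>With t = 1/y one has dt/dy = - t^2, and differentiating p(t) exp(-t) gives t^2 (p(t) -
  p'(t)) exp(-t); the factor t^2 is \<open>monom 1 2\<close>. The only delicate point is y =
  0.\<close>

lemma flat_has_derivative:
  "(flat p has_real_derivative flat (monom 1 2 * (p - pderiv p)) y) (at y)"
proof (rule linorder_cases[of y 0])
  assume "y < 0"
  have "((\<lambda>_. 0) has_real_derivative 0) (at y)" by simp
  then have "(flat p has_real_derivative 0) (at y)"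
    by (rule has_field_derivative_transform_within_open[where S = "{..<0}"])
       (use \<open>y < 0\<close> in \<open>auto simp: flat_def\<close>)
  then show ?thesis using \<open>y < 0\<close> by (simp add: flat_def)
next
  assume "y > 0"
  have "((\<lambda>y. poly p (1 / y) * exp (- (1 / y))) has_real_derivative
      flat (monom 1 2 * (p - pderiv p)) y) (at y)"
    using \<open>y > 0\<close>
    by (auto intro!: derivative_eq_intros
        simp: flat_def poly_monom field_simps power2_eq_square)
  then show ?thesis
    by (rule has_field_derivative_transform_within_open[where S = "{0<..}"])
       (use \<open>y > 0\<close> in \<open>auto simp: flat_def\<close>)
next
  assume [simp]: "y = 0"
  \<comment> \<open>To the right of 0 the difference quotient is again a flat function, with
    polynomial t p(t), so it tends to 0.\<close>
  have "((\<lambda>y. flat p y / y) \<longlongrightarrow> 0) (at_right 0)"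
  proof (rule Lim_transform_eventually[OF flat_tendsto_0_right[of "monom 1 1 * p"]])
    show "\<forall>\<^sub>F x in at_right 0. flat (monom 1 1 * p) x = flat p x / x"
      unfolding eventually_at_filter by (auto simp: flat_def poly_monom)
  qed
  moreover have "((\<lambda>y. flat p y / y) \<longlongrightarrow> 0) (at_left 0)"
    by (rule tendsto_eventually) (auto simp: eventually_at_filter flat_def)
  ultimately have "((\<lambda>y. flat p y / y) \<longlongrightarrow> 0) (at 0)"
    by (simp add: filterlim_split_at)
  then show ?thesis
    by (simp add: has_field_derivative_iff flat_def)
qed

text \<open>The chain-rule factor \<open>a\<close> is absorbed into the polynomial, so the
  derivative stays in the same family and the induction over all \<open>p\<close> closes.\<close>

lemma smooth_upto_flat_affine: "smooth_upto n (\<lambda>x. flat p (a * x + b))"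
proof (induction n arbitrary: p)
  case (Suc n)
  have *: "((\<lambda>x. flat p (a * x + b)) has_vector_derivative
      flat (smult a (monom 1 2 * (p - pderiv p))) (a * x + b)) (at x)" for x
    unfolding has_real_derivative_iff_has_vector_derivative[symmetric]
    by (rule DERIV_cong[OF DERIV_chain2[OF flat_has_derivative]])
       (auto intro!: derivative_eq_intros simp: flat_def)
  show ?case
    using Suc by (auto simp: smooth_upto_Suc vderiv_eqI[OF *] intro: differentiable_on_UNIV_I[OF *])
qed simp

text \<open>Smooth bumps that approximate the indicator of the open interval from \<open>p\<close>
  to \<open>q\<close>: \<open>flat 1\<close> is exp(-1/y) for positive y and tends to 1 at infinity,
  so a large \<open>n\<close> steepens both edges. The arguments are spelled out as
  \<open>a * x + b\<close> to match \<open>smooth_upto_flat_affine\<close>.\<close>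

definition plateau :: "real \<Rightarrow> real \<Rightarrow> nat \<Rightarrow> real \<Rightarrow> real" where
  "plateau p q n x = flat 1 (real n * x + (- real n * p)) * flat 1 (- real n * x + real n * q)"

lemma flat_1_bounds: "0 \<le> flat 1 y" "flat 1 y \<le> 1"
  by (auto simp: flat_def)

lemma plateau_altdef: "plateau p q n x = flat 1 (real n * (x - p)) * flat 1 (real n * (q - x))"
  by (simp add: plateau_def algebra_simps)

lemma plateau_eq_0: "x \<notin> {p<..<q} \<Longrightarrow> plateau p q n x = 0"
  by (auto simp: plateau_altdef flat_def zero_less_mult_iff)

lemma plateau_bounds: "0 \<le> plateau p q n x" "plateau p q n x \<le> 1"
  unfolding plateau_def by (auto intro!: mult_nonneg_nonneg mult_le_one flat_1_bounds)

lemma plateau_test_function: "plateau p q n \<in> test_functions"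
proof -
  have "smooth_upto k (plateau p q n)" for k
    using smooth_upto_mult[OF smooth_upto_flat_affine smooth_upto_flat_affine]
    unfolding plateau_def .
  moreover have "\<bar>x\<bar> > max \<bar>p\<bar> \<bar>q\<bar> \<Longrightarrow> plateau p q n x = 0" for x
    by (rule plateau_eq_0) auto
  ultimately show ?thesis
    unfolding test_functions_iff by blast
qed

lemma flat_1_mult_tendsto:
  assumes "d > 0"
  shows "(\<lambda>n. flat 1 (real n * d)) \<longlonglongrightarrow> 1"
proof -
  have "(\<lambda>n. exp (- ((1 / d) * (1 / real n)))) \<longlonglongrightarrow> exp (- ((1 / d) * 0))"
    by (intro tendsto_intros lim_1_over_n)
  then have "(\<lambda>n. exp (- ((1 / d) * (1 / real n)))) \<longlonglongrightarrow> 1" by simp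
  \<comment> \<open>The sequences differ at n = 0: there 1/0 = 0 makes the exponential 1, whereas
    \<open>flat 1 0\<close> is 0.\<close>
  then show ?thesis
    by (rule Lim_transform_eventually)
       (use assms in \<open>auto intro!: eventually_sequentiallyI[of 1] simp: flat_def field_simps\<close>)
qed

lemma plateau_tendsto: "(\<lambda>n. plateau p q n x) \<longlonglongrightarrow> indicator {p<..<q} x"
proof (cases "x \<in> {p<..<q}")
  case True
  have "(\<lambda>n. flat 1 (real n * (x - p)) * flat 1 (real n * (q - x))) \<longlonglongrightarrow> 1 * 1"
    using True by (intro tendsto_mult flat_1_mult_tendsto) auto
  then show ?thesis using True by (simp add: plateau_altdef)
qed (simp add: plateau_eq_0)


section \<open>Primitives and weak derivatives\<close>

lemma L1_loc_set_integrable: "f \<in> L1_loc \<Longrightarrow> set_integrable lborel {a..b::real} f"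
  by (simp add: L1_loc_def)

lemma integrable_imp_L1_loc: "integrable lborel f \<Longrightarrow> f \<in> L1_loc"
  unfolding L1_loc_def set_integrable_def mem_Collect_eq
  by (intro allI impI integrable_mult_indicator) (simp_all add: borel_compact)

lemma continuous_imp_L1_loc: "continuous_on UNIV f \<Longrightarrow> f \<in> L1_loc"
  unfolding L1_loc_def set_integrable_def mem_Collect_eq
  by (intro allI impI borel_integrable_compact) (simp_all add: continuous_on_subset[of UNIV])

lemma L1_loc_add: "f \<in> L1_loc \<Longrightarrow> g \<in> L1_loc \<Longrightarrow> (\<lambda>x. f x + g x) \<in> L1_loc"
  by (auto simp: L1_loc_def)

lemma L1_loc_continuous_scaleR:
  assumes f: "f \<in> L1_loc" and c: "continuous_on UNIV c"
  shows "(\<lambda>x. c x *\<^sub>R f x) \<in> L1_loc"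
proof -
  have "set_integrable lborel K (\<lambda>x. c x *\<^sub>R f x)" if K: "compact K" for K
  proof -
    have "bounded (c ` K)"
      using K c by (intro compact_imp_bounded compact_continuous_image continuous_on_subset[OF c]) auto
    then obtain M where M: "\<And>x. x \<in> K \<Longrightarrow> \<bar>c x\<bar> \<le> M"
      by (auto simp: bounded_iff)
    have int: "integrable lborel (\<lambda>x. indicator K x *\<^sub>R f x)"
      using f K by (auto simp: L1_loc_def set_integrable_def)
    have [measurable]: "c \<in> borel_measurable borel"
      by (rule borel_measurable_continuous_onI[OF c])
    have "integrable lborel (\<lambda>x. c x *\<^sub>R (indicator K x *\<^sub>R f x))"
    proof (rule Bochner_Integration.integrable_bound[OF integrable_scaleR_right[OF int, of M]])
      show "(\<lambda>x. c x *\<^sub>R indicat_real K x *\<^sub>R f x) \<in> borel_measurable lborel"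
        using borel_measurable_integrable[OF int] by measurable
      show "AE x in lborel. norm (c x *\<^sub>R indicat_real K x *\<^sub>R f x) \<le> norm (M *\<^sub>R indicat_real K x *\<^sub>R f x)"
      proof (rule AE_I2)
        show "norm (c x *\<^sub>R indicat_real K x *\<^sub>R f x) \<le> norm (M *\<^sub>R indicat_real K x *\<^sub>R f x)" for x
        proof (cases "x \<in> K")
          case True
          then have "\<bar>c x\<bar> * norm (f x) \<le> \<bar>M\<bar> * norm (f x)"
            using M[OF True] by (intro mult_right_mono) auto
          then show ?thesis using True by simp
        qed simp
      qed
    qed
    then show ?thesis by (simp add: set_integrable_def mult.commute)
  qed
  then show ?thesis by (simp add: L1_loc_def)
qed

lemma L1_loc_continuous_mult:
  fixes f c :: "real \<Rightarrow> real"
  shows "f \<in> L1_loc \<Longrightarrow> continuous_on UNIV c \<Longrightarrow> (\<lambda>x. c x * f x) \<in> L1_loc"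
  using L1_loc_continuous_scaleR[of f c] by simp

lemma L1_loc_cmult:
  fixes f :: "real \<Rightarrow> real"
  shows "f \<in> L1_loc \<Longrightarrow> (\<lambda>x. k * f x) \<in> L1_loc"
  using L1_loc_continuous_mult[of f "\<lambda>_. k"] by simp

lemma L1_loc_diff:
  fixes f g :: "real \<Rightarrow> real"
  shows "f \<in> L1_loc \<Longrightarrow> g \<in> L1_loc \<Longrightarrow> (\<lambda>x. f x - g x) \<in> L1_loc"
  using L1_loc_add[of f "\<lambda>x. (-1) * g x"] L1_loc_cmult[of g "-1"] by simp

lemma integrable_eq_set_integral:
  fixes f :: "real \<Rightarrow> 'a::{banach, second_countable_topology}"
  assumes "f \<in> L1_loc" "\<And>x. x \<notin> {a..b} \<Longrightarrow> f x = 0"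
  shows "integrable lborel f" "(LINT x|lborel. f x) = (LINT x:{a..b}|lborel. f x)"
proof -
  have "(\<lambda>x. indicator {a..b} x *\<^sub>R f x) = f"
    using assms(2) by (auto simp: indicator_def fun_eq_iff)
  then show "integrable lborel f" "(LINT x|lborel. f x) = (LINT x:{a..b}|lborel. f x)"
    using L1_loc_set_integrable[OF assms(1), of a b]
    by (simp_all add: set_integrable_def set_lebesgue_integral_def)
qed

lemma test_function_support:
  assumes "\<phi> \<in> test_functions"
  obtains M where "M > 0" "\<And>x. \<bar>x\<bar> \<ge> M \<Longrightarrow> \<phi> x = 0" "\<And>x. \<bar>x\<bar> \<ge> M \<Longrightarrow> vderiv \<phi> x = 0"
proof -
  obtain M where M: "\<forall>x. \<bar>x\<bar> > M \<longrightarrow> \<phi> x = 0"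
    using assms unfolding test_functions_iff by blast
  have *: "\<bar>x\<bar> > M" if "\<bar>x\<bar> \<ge> \<bar>M\<bar> + 1" for x
    using that by linarith
  show thesis
  proof (rule that[of "\<bar>M\<bar> + 1"])
    show "\<phi> x = 0" "vderiv \<phi> x = 0" if "\<bar>x\<bar> \<ge> \<bar>M\<bar> + 1" for x
      using M *[OF that] vderiv_zero_outside[OF M *[OF that]] by blast+
  qed simp
qed

lemma integrable_test_scaleR:
  fixes \<phi> :: "real \<Rightarrow> real"
  assumes \<phi>: "\<phi> \<in> test_functions" and f: "f \<in> L1_loc"
  shows "integrable lborel (\<lambda>x. \<phi> x *\<^sub>R f x)"
proof -
  obtain M where M: "\<And>x. \<bar>x\<bar> \<ge> M \<Longrightarrow> \<phi> x = 0"
    by (rule test_function_support[OF \<phi>]) blast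
  show ?thesis
  proof (rule integrable_eq_set_integral(1))
    show "(\<lambda>x. \<phi> x *\<^sub>R f x) \<in> L1_loc"
      by (rule L1_loc_continuous_scaleR[OF f test_functions_continuous[OF \<phi>]])
    show "\<phi> x *\<^sub>R f x = 0" if "x \<notin> {-M..M}" for x
    proof -
      have "\<bar>x\<bar> \<ge> M" using that unfolding atLeastAtMost_iff by linarith
      then show ?thesis by (simp add: M)
    qed
  qed
qed

lemma integrable_test_mult:
  fixes \<phi> f :: "real \<Rightarrow> real"
  shows "\<phi> \<in> test_functions \<Longrightarrow> f \<in> L1_loc \<Longrightarrow> integrable lborel (\<lambda>x. \<phi> x * f x)"
  using integrable_test_scaleR[of \<phi> f] by simp

section \<open>Functions determined almost everywhere by their integrals\<close>

lemma AE_zero_if_integrals_zero: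
  fixes g :: "real \<Rightarrow> real"
  assumes g: "integrable lborel g"
    and zero: "\<And>x y. x \<le> y \<Longrightarrow> (LINT t:{x..y}|lborel. g t) = 0"
  shows "AE x in lborel. g x = 0"
proof (rule sigma_finite_measure.density_zero[OF sigma_finite_lborel g])
  have int: "set_integrable lborel S g" if "S \<in> sets borel" for S
    using integrable_mult_indicator[OF _ g, of S] that by (simp add: set_integrable_def)
  \<comment> \<open>The complement case of the induction below subtracts from the integral over the
    whole line, which is a limit over growing intervals.\<close>
  have UNIV0: "(LINT t|lborel. g t) = 0"
  proof -
    have "(\<lambda>n. LINT t:{- real n..real n}|lborel. g t) \<longlonglongrightarrow> (LINT t:(\<Union>n. {- real n..real n})|lborel. g t)"
      by (rule set_integral_cont_up) (auto simp: incseq_def int)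
    moreover have "(\<Union>n. {- real n..real n}) = UNIV"
    proof -
      have "x \<in> (\<Union>n. {- real n..real n})" for x
        using real_arch_simple[of "\<bar>x\<bar>"] by (auto simp: abs_le_iff minus_le_iff)
      then show ?thesis by blast
    qed
    ultimately have "(\<lambda>n. 0::real) \<longlonglongrightarrow> (LINT t:UNIV|lborel. g t)"
      by (simp add: zero)
    then show ?thesis
      using LIMSEQ_unique[OF _ tendsto_const] by (simp add: set_lebesgue_integral_def)
  qed
  fix S :: "real set" assume "S \<in> sets lborel"
  then have "S \<in> sets borel" by simp
  then show "(LINT t:S|lborel. g t) = 0"
  proof (induction rule: borel_set_induct)
    case (compl A)
    have "(LINT t:-A \<union> A|lborel. g t) = (LINT t:-A|lborel. g t) + (LINT t:A|lborel. g t)"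
      using compl by (intro set_integral_Un int) auto
    then show ?case using compl UNIV0 by (simp add: set_lebesgue_integral_def)
  next
    case (union f)
    then show ?case
      by (subst lebesgue_integral_countable_add)
         (auto intro!: int simp: disjoint_family_on_def)
  next
    case empty
    then show ?case by (simp add: set_lebesgue_integral_def)
  next
    case (interval a b)
    then show ?case by (rule zero)
  qed
qed

text \<open>The hypothesis only reaches compact subintervals, so the open interval is exhausted by
  countably many of them and \<open>f\<close> is truncated to each, which also makes it globally
  integrable.\<close>

lemma AE_zero_if_integrals_zero_local:
  fixes f :: "real \<Rightarrow> real"
  assumes f: "f \<in> L1_loc"
    and zero: "\<And>x y. a < x \<Longrightarrow> x \<le> y \<Longrightarrow> y < b \<Longrightarrow> (LINT t:{x..y}|lborel. f t) = 0"
  shows "AE x in lborel. x \<in> {a<..<b} \<longrightarrow> f x = 0"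
proof -
  have "AE x in lborel. indicator {a + 1 / Suc n..b - 1 / Suc n} x * f x = 0" for n
  proof (rule AE_zero_if_integrals_zero)
    let ?I = "{a + 1 / Suc n..b - 1 / Suc n}"
    show "integrable lborel (\<lambda>x. indicator ?I x * f x)"
      using L1_loc_set_integrable[OF f, of "a + 1 / Suc n" "b - 1 / Suc n"] by (simp add: set_integrable_def)
    fix x y :: real
    have "(LINT t:{x..y}|lborel. indicator ?I t * f t)
        = (LINT t:{max x (a + 1 / Suc n)..min y (b - 1 / Suc n)}|lborel. f t)"
      unfolding set_lebesgue_integral_def
      by (rule Bochner_Integration.integral_cong) (auto simp: indicator_def)
    also have "\<dots> = 0"
    proof (cases "max x (a + 1 / Suc n) \<le> min y (b - 1 / Suc n)")
      case True
      define d where "d = 1 / real (Suc n)"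
      have "0 < d" by (simp add: d_def)
      then show ?thesis using True unfolding d_def[symmetric]
        by (intro zero) linarith+
    next
      case False
      then have "{max x (a + 1 / Suc n)..min y (b - 1 / Suc n)} = {}" by auto
      then show ?thesis by (simp add: set_lebesgue_integral_def)
    qed
    finally show "(LINT t:{x..y}|lborel. indicator ?I t * f t) = 0" .
  qed
  then have "AE x in lborel. \<forall>n. indicator {a + 1 / Suc n..b - 1 / Suc n} x * f x = 0"
    unfolding AE_all_countable by blast
  then show ?thesis
  proof eventually_elim
    case (elim x)
    show ?case
    proof
      assume x: "x \<in> {a<..<b}"
      then have "min (x - a) (b - x) > 0" by simp
      then obtain n where "1 / real (Suc n) < min (x - a) (b - x)"
        using nat_approx_posE by blast
      then have "x \<in> {a + 1 / Suc n..b - 1 / Suc n}" by simp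
      then show "f x = 0" using elim[rule_format, of n] by simp
    qed
  qed
qed

lemma AE_zero_if_all_integrals_zero:
  fixes f :: "real \<Rightarrow> real"
  assumes f: "f \<in> L1_loc"
    and zero: "\<And>x y. x \<le> y \<Longrightarrow> (LINT t:{x..y}|lborel. f t) = 0"
  shows "AE x in lborel. f x = 0"
proof -
  have "AE x in lborel. \<forall>n. x \<in> {- real n<..<real n} \<longrightarrow> f x = 0"
    unfolding AE_all_countable using AE_zero_if_integrals_zero_local[OF f zero] by blast
  then show ?thesis
  proof eventually_elim
    case (elim x)
    obtain n where "\<bar>x\<bar> < real n" using reals_Archimedean2 by blast
    then show ?case using elim by (auto simp: abs_less_iff)
  qed
qed

text \<open>Dominated convergence along the plateau functions, with |f| cut off to the closed
  interval as majorant. The limit sees the open interval; the two endpoints are null.\<close>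

lemma set_integral_zero_if_test_integrals_zero:
  fixes f :: "real \<Rightarrow> real"
  assumes f: "f \<in> L1_loc"
    and zero: "\<And>\<phi> :: real \<Rightarrow> real. \<phi> \<in> test_functions \<Longrightarrow> (LINT x|lborel. \<phi> x * f x) = 0"
  shows "(LINT t:{p..q}|lborel. f t) = 0"
proof -
  have int: "integrable lborel (\<lambda>x. indicator {p..q} x *\<^sub>R f x)"
    using L1_loc_set_integrable[OF f] by (simp add: set_integrable_def)
  note borel_measurable_integrable[OF int, measurable]
  have [measurable]: "plateau p q n \<in> borel_measurable lborel" for n
    using test_functions_continuous[OF plateau_test_function] by (simp add: borel_measurable_continuous_onI)
  have eq: "plateau p q n x * f x = plateau p q n x * (indicator {p..q} x *\<^sub>R f x)" for n x
    using plateau_eq_0[of x p q n] by (cases "x \<in> {p<..<q}") auto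
  have "(\<lambda>n. LINT x|lborel. plateau p q n x * f x) \<longlonglongrightarrow>
        (LINT x|lborel. indicator {p<..<q} x * (indicator {p..q} x *\<^sub>R f x))"
  proof (rule integral_dominated_convergence[where w = "\<lambda>x. norm (indicator {p..q} x *\<^sub>R f x)"])
    show "(\<lambda>x. indicat_real {p<..<q} x * indicat_real {p..q} x *\<^sub>R f x) \<in> borel_measurable lborel"
      by measurable
    show "(\<lambda>x. plateau p q n x * f x) \<in> borel_measurable lborel" for n
      unfolding eq by measurable
    show "integrable lborel (\<lambda>x. norm (indicat_real {p..q} x *\<^sub>R f x))"
      using int by (rule integrable_norm)
    show "AE x in lborel. (\<lambda>n. plateau p q n x * f x) \<longlonglongrightarrow> indicat_real {p<..<q} x * indicat_real {p..q} x *\<^sub>R f x"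
      unfolding eq by (intro AE_I2 tendsto_mult_right plateau_tendsto)
    show "AE x in lborel. norm (plateau p q n x * f x) \<le> norm (indicat_real {p..q} x *\<^sub>R f x)" for n
      unfolding eq norm_mult using plateau_bounds[of p q n]
      by (intro AE_I2 mult_left_le_one_le) auto
  qed
  then have "(LINT x|lborel. indicator {p<..<q} x * (indicator {p..q} x *\<^sub>R f x)) = 0"
    using zero[OF plateau_test_function] LIMSEQ_unique[of "\<lambda>n. 0::real"] by simp
  also have "(LINT x|lborel. indicator {p<..<q} x * (indicator {p..q} x *\<^sub>R f x)) = (LINT t:{p<..<q}|lborel. f t)"
    unfolding set_lebesgue_integral_def
    by (rule Bochner_Integration.integral_cong) (auto simp: indicator_def)
  also have "\<dots> = (LINT t:{p..q}|lborel. f t)"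
    by (rule set_integral_discrete_difference[where X = "{p, q}"]) auto
  finally show ?thesis .
qed

text \<open>Local absolute continuity of \<open>F\<close> with derivative \<open>f\<close>, encoded
  by the integral identity so that no almost-everywhere differentiation theorem is required. The
  restriction to x \<le> y matters: the set integral over a reversed interval is 0, not the
  negative.\<close>

definition is_primitive :: "(real \<Rightarrow> real) \<Rightarrow> (real \<Rightarrow> real) \<Rightarrow> bool" where
  "is_primitive F f \<longleftrightarrow>
     f \<in> L1_loc \<and> (\<forall>x y. x \<le> y \<longrightarrow> F y - F x = (LINT t:{x..y}|lborel. f t))"

lemma is_primitiveD:
  "is_primitive F f \<Longrightarrow> x \<le> y \<Longrightarrow> F y - F x = (LINT t:{x..y}|lborel. f t)"
  "is_primitive F f \<Longrightarrow> f \<in> L1_loc"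
  by (auto simp: is_primitive_def)

lemma ex_primitive:
  assumes f: "f \<in> L1_loc"
  shows "\<exists>F. is_primitive F f"
proof -
  have "(LBINT t=ereal 0..y. f t) - (LBINT t=ereal 0..x. f t) = (LINT t:{x..y}|lborel. f t)" if "x \<le> y" for x y :: real
  proof -
    have "interval_lebesgue_integrable lborel (ereal p) (ereal q) f" for p q
      unfolding interval_lebesgue_integrable_def
      using set_integrable_subset[OF L1_loc_set_integrable[OF f, of p q], of "{p<..<q}"]
        set_integrable_subset[OF L1_loc_set_integrable[OF f, of q p], of "{q<..<p}"]
      by (simp add: greaterThanLessThan_subseteq_atLeastAtMost_iff)
    from this[of "min 0 (min x y)" "max 0 (max x y)"]
    have "(LBINT t=ereal 0..x. f t) + (LBINT t=x..y. f t) = (LBINT t=ereal 0..y. f t)"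
      unfolding ereal_min ereal_max by (rule interval_integral_sum)
    then show ?thesis
      unfolding interval_integral_Icc[OF that, of f] by linarith
  qed
  note prim = this
  show ?thesis
    unfolding is_primitive_def
  proof (rule exI[of _ "\<lambda>x. LBINT t=ereal 0..ereal x. f t"], intro conjI allI impI)
    show "f \<in> L1_loc" by (rule f)
  qed (rule prim)
qed

lemma is_primitive_Icc:
  assumes "is_primitive F f" "x \<in> {a..b}"
  shows "F x = F a + integral {a..x} f"
proof -
  have "F x - F a = (LINT t:{a..x}|lborel. f t)"
    using is_primitiveD(1)[OF assms(1), of a x] assms(2) by simp
  also have "\<dots> = integral {a..x} f"
    by (rule set_borel_integral_eq_integral) (rule L1_loc_set_integrable[OF is_primitiveD(2)[OF assms(1)]])
  finally show ?thesis by simp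
qed

lemma is_primitive_continuous:
  assumes F: "is_primitive F f"
  shows "continuous_on UNIV F"
proof -
  have "continuous_on {x - 1..x + 1} F" for x
  proof -
    have "f integrable_on {x - 1..x + 1}"
      using L1_loc_set_integrable[OF is_primitiveD(2)[OF F]] by (rule set_borel_integral_eq_integral)
    then have "continuous_on {x - 1..x + 1} (\<lambda>y. F (x - 1) + integral {x - 1..y} f)"
      by (intro continuous_intros indefinite_integral_continuous_1)
    then show ?thesis
      by (rule continuous_on_eq) (rule is_primitive_Icc[OF F, symmetric])
  qed
  then have "isCont F x" for x
    by (rule continuous_on_interior[of "{x - 1..x + 1}"]) simp
  then show ?thesis
    by (simp add: continuous_on_eq_continuous_at)
qed

lemma is_primitive_has_vector_derivative:
  assumes F: "is_primitive F f" and f: "continuous_on UNIV f"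
  shows "(F has_vector_derivative f x) (at x)"
proof -
  have "((\<lambda>y. F (x - 1) + integral {x - 1..y} f) has_vector_derivative f x) (at x within {x - 1..x + 1})"
    using has_vector_derivative_add[OF has_vector_derivative_const[of "F (x - 1)"]
        integral_has_vector_derivative[OF continuous_on_subset[OF f subset_UNIV], of x "x - 1" "x + 1"]]
    by simp
  then have "(F has_vector_derivative f x) (at x within {x - 1..x + 1})"
    by (rule has_vector_derivative_transform[rotated 2]) (simp, rule is_primitive_Icc[OF F])
  then show ?thesis
    by (simp add: at_within_Icc_at)
qed

lemma is_primitive_add:
  assumes F: "is_primitive F f" and G: "is_primitive G g"
  shows "is_primitive (\<lambda>x. F x + G x) (\<lambda>x. f x + g x)"
  unfolding is_primitive_def
proof (intro conjI allI impI)
  show "(\<lambda>x. f x + g x) \<in> L1_loc"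
    by (intro L1_loc_add is_primitiveD(2)[OF F] is_primitiveD(2)[OF G])
  fix x y :: real assume "x \<le> y"
  then show "F y + G y - (F x + G x) = (LINT t:{x..y}|lborel. f t + g t)"
    using is_primitiveD(1)[OF F, of x y] is_primitiveD(1)[OF G, of x y]
    by (simp add: L1_loc_set_integrable is_primitiveD(2)[OF F] is_primitiveD(2)[OF G])
qed

lemma is_primitive_cmult:
  assumes F: "is_primitive F f"
  shows "is_primitive (\<lambda>x. k * F x) (\<lambda>x. k * f x)"
  using F by (auto simp: is_primitive_def L1_loc_cmult simp flip: right_diff_distrib)

lemma is_primitive_const: "is_primitive (\<lambda>x. k) (\<lambda>x. 0)"
  by (simp add: is_primitive_def continuous_imp_L1_loc)

text \<open>Fubini after splitting the plane along the diagonal; on an interval this is integration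
  by parts for absolutely continuous functions.\<close>

lemma integral_mult_integral_by_order:
  fixes f g :: "real \<Rightarrow> real"
  assumes f: "integrable lborel f" and g: "integrable lborel g"
  shows "(LINT s|lborel. f s) * (LINT t|lborel. g t)
    = (LINT s|lborel. f s * (LINT t|lborel. indicator {..s} t * g t))
      + (LINT t|lborel. g t * (LINT s|lborel. indicator {..t} s * f s))"
proof -
  note [measurable] = borel_measurable_integrable[OF f] borel_measurable_integrable[OF g]
  have ind_le: "integrable lborel (\<lambda>t. indicator {..s} t * g t)" for s
    using integrable_mult_indicator[OF _ g, of "{..s}"] by simp
  have ind_gt: "integrable lborel (\<lambda>t. indicator {s<..} t * g t)" for s
    using integrable_mult_indicator[OF _ g, of "{s<..}"] by simp
  define H where "H = (\<lambda>s t. f s * (indicator {s<..} t * g t))"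
  have H_alt: "H s t = (if s < t then f s * g t else 0)" for s t
    by (auto simp: H_def indicator_def)
  have "integrable (lborel \<Otimes>\<^sub>M lborel) (\<lambda>(s, t). f s * g t)"
    using f g by (intro lborel_pair.Fubini_integrable) (auto simp: abs_mult)
  then have H: "integrable (lborel \<Otimes>\<^sub>M lborel) (case_prod H)"
  proof (rule Bochner_Integration.integrable_bound)
    show "case_prod H \<in> borel_measurable (lborel \<Otimes>\<^sub>M lborel)"
      unfolding H_alt by measurable
  qed (auto simp: H_alt)
  have split: "(LINT t|lborel. g t) = (LINT t|lborel. indicator {..s} t * g t) + (LINT t|lborel. indicator {s<..} t * g t)" for s
    by (subst Bochner_Integration.integral_add[OF ind_le ind_gt, symmetric])
       (auto intro!: Bochner_Integration.integral_cong simp: indicator_def)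
  have Hs: "(LINT t|lborel. H s t) = f s * (LINT t|lborel. indicator {s<..} t * g t)" for s
    by (simp add: H_def)
  have fsplit: "f s * (LINT t|lborel. g t) = f s * (LINT t|lborel. indicator {..s} t * g t) + (LINT t|lborel. H s t)" for s
    unfolding Hs using split[of s] by (simp only: distrib_left)
  have int2: "integrable lborel (\<lambda>s. LINT t|lborel. H s t)"
    using lborel_pair.integrable_fst[OF H] .
  have int1: "integrable lborel (\<lambda>s. f s * (LINT t|lborel. indicator {..s} t * g t))"
  proof -
    have "integrable lborel (\<lambda>s. f s * (LINT t|lborel. g t) - (LINT t|lborel. H s t))"
      using f int2 by auto
    also have "(\<lambda>s. f s * (LINT t|lborel. g t) - (LINT t|lborel. H s t)) = (\<lambda>s. f s * (LINT t|lborel. indicator {..s} t * g t))"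
      unfolding fsplit by simp
    finally show ?thesis .
  qed
  \<comment> \<open>For fixed t, \<open>H\<close> keeps only s < t; adding the single point s = t
    turns this into the symmetric form with \<open>{..t}\<close>.\<close>
  have Ht: "(LINT s|lborel. H s t) = g t * (LINT s|lborel. indicator {..t} s * f s)" for t
  proof -
    have "(LINT s|lborel. H s t) = (LINT s|lborel. g t * (indicator {..t} s * f s))"
      by (rule integral_discrete_difference[where X = "{t}"]) (auto simp: H_alt)
    then show ?thesis by simp
  qed
  have "(LINT s|lborel. f s) * (LINT t|lborel. g t) = (LINT s|lborel. f s * (LINT t|lborel. g t))"
    by simp
  also have "\<dots> = (LINT s|lborel. f s * (LINT t|lborel. indicator {..s} t * g t) + (LINT t|lborel. H s t))"
    unfolding fsplit ..
  also have "\<dots> = (LINT s|lborel. f s * (LINT t|lborel. indicator {..s} t * g t)) + (LINT s|lborel. LINT t|lborel. H s t)"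
    by (rule Bochner_Integration.integral_add[OF int1 int2])
  also have "(LINT s|lborel. LINT t|lborel. H s t) = (LINT t|lborel. LINT s|lborel. H s t)"
    by (rule lborel_pair.Fubini_integral[OF H, symmetric])
  finally show ?thesis by (simp add: Ht)
qed

text \<open>With \<open>f\<close> and \<open>g\<close> cut off to the interval, the inner integrals
  of the Fubini identity are \<open>G s - G x\<close> and \<open>F s - F x\<close>. Expanding and
  cancelling the boundary terms leaves the product rule, with no approximation by smooth
  functions.\<close>

lemma is_primitive_mult:
  assumes F: "is_primitive F f" and G: "is_primitive G g"
  shows "is_primitive (\<lambda>x. F x * G x) (\<lambda>x. f x * G x + F x * g x)"
  unfolding is_primitive_def
proof (intro conjI allI impI)
  have fG: "(\<lambda>x. f x * G x) \<in> L1_loc"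
    using L1_loc_continuous_mult[OF is_primitiveD(2)[OF F] is_primitive_continuous[OF G]]
    by (simp add: mult.commute)
  have Fg: "(\<lambda>x. F x * g x) \<in> L1_loc"
    by (rule L1_loc_continuous_mult[OF is_primitiveD(2)[OF G] is_primitive_continuous[OF F]])
  show "(\<lambda>x. f x * G x + F x * g x) \<in> L1_loc"
    by (rule L1_loc_add[OF fG Fg])
  fix x y :: real assume "x \<le> y"
  have aux: "(LINT s|lborel. indicator {x..y} s * f s * (LINT t|lborel. indicator {..s} t * (indicator {x..y} t * g t)))
      = (LINT s:{x..y}|lborel. f s * G s) - G x * (F y - F x)"
    if F: "is_primitive F f" and G: "is_primitive G g" and fG: "(\<lambda>x. f x * G x) \<in> L1_loc" for F G f g
  proof -
    have "indicator {x..y} s * f s * (LINT t|lborel. indicator {..s} t * (indicator {x..y} t * g t))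
        = indicator {x..y} s *\<^sub>R (f s * G s - G x * f s)" for s
    proof (cases "s \<in> {x..y}")
      case True
      have "(LINT t|lborel. indicator {..s} t * (indicator {x..y} t * g t)) = (LINT t:{x..s}|lborel. g t)"
        unfolding set_lebesgue_integral_def
        using True by (intro Bochner_Integration.integral_cong) (auto simp: indicator_def)
      also have "\<dots> = G s - G x"
        using is_primitiveD(1)[OF G, of x s] True by simp
      finally have "(LINT t|lborel. indicator {..s} t * (indicator {x..y} t * g t)) = G s - G x" .
      then show ?thesis using True unfolding \<open>(LINT t|lborel. indicator {..s} t * (indicator {x..y} t * g t)) = G s - G x\<close>
        by (simp add: right_diff_distrib mult.commute)
    qed simp
    then have "(LINT s|lborel. indicator {x..y} s * f s * (LINT t|lborel. indicator {..s} t * (indicator {x..y} t * g t)))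
        = (LINT s:{x..y}|lborel. f s * G s - G x * f s)"
      unfolding set_lebesgue_integral_def by (rule Bochner_Integration.integral_cong[OF refl])
    also have "\<dots> = (LINT s:{x..y}|lborel. f s * G s) - (LINT s:{x..y}|lborel. G x * f s)"
      by (intro set_integral_diff L1_loc_set_integrable fG L1_loc_cmult is_primitiveD(2)[OF F])
    finally show ?thesis
      using is_primitiveD(1)[OF F \<open>x \<le> y\<close>] by simp
  qed
  have int: "integrable lborel (\<lambda>s. indicator {x..y} s * f s)" if "f \<in> L1_loc" for f :: "real \<Rightarrow> real"
    using L1_loc_set_integrable[OF that] by (simp add: set_integrable_def)
  have Gf: "(\<lambda>x. g x * F x) \<in> L1_loc" using Fg by (simp only: mult.commute)
  have "(F y - F x) * (G y - G x)
      = (LINT s|lborel. indicator {x..y} s * f s) * (LINT t|lborel. indicator {x..y} t * g t)"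
    using is_primitiveD(1)[OF F \<open>x \<le> y\<close>] is_primitiveD(1)[OF G \<open>x \<le> y\<close>]
    by (simp add: set_lebesgue_integral_def)
  also have "\<dots> = (LINT s:{x..y}|lborel. f s * G s) - G x * (F y - F x)
      + ((LINT s:{x..y}|lborel. g s * F s) - F x * (G y - G x))"
    unfolding integral_mult_integral_by_order[OF int[OF is_primitiveD(2)[OF F]] int[OF is_primitiveD(2)[OF G]]]
    unfolding aux[OF F G fG] aux[OF G F Gf] ..
  finally have "F y * G y - F x * G x = (LINT s:{x..y}|lborel. f s * G s) + (LINT s:{x..y}|lborel. g s * F s)"
    by algebra
  also have "(LINT s:{x..y}|lborel. g s * F s) = (LINT s:{x..y}|lborel. F s * g s)"
    by (simp only: mult.commute)
  finally have "F y * G y - F x * G x = (LINT s:{x..y}|lborel. f s * G s) + (LINT s:{x..y}|lborel. F s * g s)" .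
  then show "F y * G y - F x * G x = (LINT s:{x..y}|lborel. f s * G s + F s * g s)"
    by (simp only: set_integral_add(2)[OF L1_loc_set_integrable[OF fG] L1_loc_set_integrable[OF Fg]])
qed

lemma test_function_is_primitive:
  fixes \<phi> :: "real \<Rightarrow> real"
  assumes "\<phi> \<in> test_functions"
  shows "is_primitive \<phi> (vderiv \<phi>)"
  unfolding is_primitive_def
proof (intro conjI allI impI)
  show L: "vderiv \<phi> \<in> L1_loc"
    by (rule continuous_imp_L1_loc[OF test_functions_continuous[OF test_functions_vderiv[OF assms]]])
  fix x y :: real assume "x \<le> y"
  then have "(vderiv \<phi> has_integral (\<phi> y - \<phi> x)) {x..y}"
    by (rule fundamental_theorem_of_calculus)
       (rule has_vector_derivative_at_within[OF has_vector_derivative_vderiv[OF test_functions_differentiable[OF assms]]])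
  then show "\<phi> y - \<phi> x = (LINT t:{x..y}|lborel. vderiv \<phi> t)"
    unfolding set_borel_integral_eq_integral(2)[OF L1_loc_set_integrable[OF L]]
    by (rule integral_unique[symmetric])
qed

text \<open>The product of \<phi> and \<open>F\<close> is a primitive of the sum of both integrands
  and vanishes at the two ends of an interval containing the support.\<close>

lemma is_primitive_weak:
  fixes \<phi> :: "real \<Rightarrow> real"
  assumes F: "is_primitive F f" and \<phi>: "\<phi> \<in> test_functions"
  shows "(LINT x|lborel. vderiv \<phi> x * F x) = - (LINT x|lborel. \<phi> x * f x)"
proof -
  obtain M where M: "M > 0" "\<And>x. \<bar>x\<bar> \<ge> M \<Longrightarrow> \<phi> x = 0" "\<And>x. \<bar>x\<bar> \<ge> M \<Longrightarrow> vderiv \<phi> x = 0"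
    by (rule test_function_support[OF \<phi>]) blast
  note P = is_primitive_mult[OF test_function_is_primitive[OF \<phi>] F]
  have "(LINT x|lborel. vderiv \<phi> x * F x) + (LINT x|lborel. \<phi> x * f x)
      = (LINT x|lborel. vderiv \<phi> x * F x + \<phi> x * f x)"
    by (rule Bochner_Integration.integral_add[symmetric,
        OF integrable_test_mult[OF test_functions_vderiv[OF \<phi>] continuous_imp_L1_loc[OF is_primitive_continuous[OF F]]]
           integrable_test_mult[OF \<phi> is_primitiveD(2)[OF F]]])
  also have "\<dots> = (LINT x:{-M..M}|lborel. vderiv \<phi> x * F x + \<phi> x * f x)"
  proof (rule integrable_eq_set_integral(2)[OF is_primitiveD(2)[OF P]])
    show "vderiv \<phi> x * F x + \<phi> x * f x = 0" if "x \<notin> {-M..M}" for x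
    proof -
      have "\<bar>x\<bar> \<ge> M" using that unfolding atLeastAtMost_iff by linarith
      then show ?thesis by (simp add: M(2,3))
    qed
  qed
  also have "\<dots> = \<phi> M * F M - \<phi> (-M) * F (-M)"
    by (rule is_primitiveD(1)[OF P, symmetric]) (use M(1) in simp)
  also have "\<dots> = 0" using M(1) M(2)[of M] M(2)[of "-M"] by simp
  finally show ?thesis by simp
qed

section \<open>The du Bois-Reymond lemma and representatives of weakly differentiable
  functions\<close>

lemma test_function_antiderivative:
  fixes \<phi> :: "real \<Rightarrow> real"
  assumes \<phi>: "\<phi> \<in> test_functions" and mean: "(LINT x|lborel. \<phi> x) = 0"
  obtains \<psi> where "\<psi> \<in> test_functions" "vderiv \<psi> = \<phi>"
proof -
  note cont = test_functions_continuous[OF \<phi>]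
  have L: "\<phi> \<in> L1_loc" by (rule continuous_imp_L1_loc[OF cont])
  obtain F where F: "is_primitive F \<phi>" using ex_primitive[OF L] by blast
  obtain M where M: "M > 0" "\<And>x. \<bar>x\<bar> \<ge> M \<Longrightarrow> \<phi> x = 0"
    by (rule test_function_support[OF \<phi>]) blast
  \<comment> \<open>Subtracting the value at -M makes \<psi> vanish to the left of the support;
    vanishing to the right is exactly the zero-mean hypothesis.\<close>
  define \<psi> where "\<psi> = (\<lambda>x. F x - F (-M))"
  have d: "(\<psi> has_vector_derivative \<phi> x) (at x)" for x
    using has_vector_derivative_diff[OF is_primitive_has_vector_derivative[OF F cont] has_vector_derivative_const]
    by (simp add: \<psi>_def)
  have "\<psi> x = 0" if "\<bar>x\<bar> > M" for x
  proof (cases "x > 0")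
    case True
    then have "\<psi> x = (LINT t:{-M..x}|lborel. \<phi> t)"
      using is_primitiveD(1)[OF F, of "-M" x] M(1) by (simp add: \<psi>_def)
    also have "\<dots> = (LINT t|lborel. \<phi> t)"
    proof (rule integrable_eq_set_integral(2)[OF L, symmetric])
      show "\<phi> t = 0" if "t \<notin> {-M..x}" for t
      proof -
        have "\<bar>t\<bar> \<ge> M" using that \<open>\<bar>x\<bar> > M\<close> True unfolding atLeastAtMost_iff by linarith
        then show ?thesis by (rule M(2))
      qed
    qed
    finally show ?thesis using mean by simp
  next
    case False
    then have "- \<psi> x = (LINT t:{x..-M}|lborel. \<phi> t)"
      using is_primitiveD(1)[OF F, of x "-M"] that by (simp add: \<psi>_def)
    also have "\<dots> = (LINT t:{x..-M}|lborel. 0)"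
    proof (rule set_lebesgue_integral_cong)
      show "\<forall>t. t \<in> {x..-M} \<longrightarrow> \<phi> t = 0"
      proof (intro allI impI M(2))
        show "\<bar>t\<bar> \<ge> M" if "t \<in> {x..-M}" for t
          using that unfolding atLeastAtMost_iff by linarith
      qed
    qed simp
    finally show ?thesis by simp
  qed
  moreover have "smooth_upto n \<psi>" for n
  proof (rule smooth_upto_mono)
    show "smooth_upto (Suc n) \<psi>"
      using \<phi> differentiable_on_UNIV_I[OF d] by (simp add: smooth_upto_Suc vderiv_eqI[OF d] test_functions_iff)
  qed simp
  ultimately have "\<psi> \<in> test_functions" unfolding test_functions_iff by blast
  then show thesis by (rule that) (rule vderiv_eqI[OF d])
qed

text \<open>Fix a test function \<eta> with nonzero integral. Any \<phi> minus a suitable multiple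
  of \<eta> has mean zero, hence is the derivative of a test function, and the hypothesis applies to
  it. This forces the constant to be the \<eta>-weighted mean of \<open>f\<close>.\<close>

lemma du_Bois_Reymond:
  fixes f :: "real \<Rightarrow> real"
  assumes f: "f \<in> L1_loc"
    and zero: "\<And>\<phi> :: real \<Rightarrow> real. \<phi> \<in> test_functions \<Longrightarrow> (LINT x|lborel. vderiv \<phi> x * f x) = 0"
  shows "\<exists>C. AE x in lborel. f x = C"
proof -
  have one: "(\<lambda>_. 1::real) \<in> L1_loc" by (simp add: continuous_imp_L1_loc)
  have int1: "integrable lborel \<phi>" if "\<phi> \<in> test_functions" for \<phi> :: "real \<Rightarrow> real"
    using integrable_test_mult[OF that one] by simp
  \<comment> \<open>If every test function had integral 0, then the constant 1 would have integral 0
    over [0, 1].\<close>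
  obtain \<eta> :: "real \<Rightarrow> real" where \<eta>: "\<eta> \<in> test_functions" "(LINT x|lborel. \<eta> x) \<noteq> 0"
    using set_integral_zero_if_test_integrals_zero[OF one, of 0 1] by (auto simp: set_lebesgue_integral_def)
  define m where "m = (LINT x|lborel. \<eta> x)"
  define C where "C = (LINT x|lborel. \<eta> x * f x) / m"
  have "m \<noteq> 0" using \<eta> by (simp add: m_def)
  have fC: "(\<lambda>x. f x - C) \<in> L1_loc"
    by (intro L1_loc_diff f continuous_imp_L1_loc) simp
  have "(LINT x|lborel. \<phi> x * (f x - C)) = 0" if \<phi>: "\<phi> \<in> test_functions" for \<phi> :: "real \<Rightarrow> real"
  proof -
    define k where "k = (LINT x|lborel. \<phi> x) / m"
    have "(\<lambda>x. \<phi> x + \<eta> x *\<^sub>R (- k)) \<in> test_functions"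
      by (intro test_functions_add test_functions_scaleR_left \<phi> \<eta>)
    moreover have "(LINT x|lborel. \<phi> x + \<eta> x *\<^sub>R (- k)) = 0"
      using int1[OF \<phi>] int1[OF \<eta>(1)] \<open>m \<noteq> 0\<close> by (simp add: k_def flip: m_def)
    ultimately obtain \<psi> where "\<psi> \<in> test_functions" "vderiv \<psi> = (\<lambda>x. \<phi> x + \<eta> x *\<^sub>R (- k))"
      using test_function_antiderivative by blast
    then have "0 = (LINT x|lborel. (\<phi> x + \<eta> x *\<^sub>R (- k)) * f x)"
      using zero[of \<psi>] by simp
    also have "\<dots> = (LINT x|lborel. \<phi> x * f x - k * (\<eta> x * f x))"
      by (simp add: algebra_simps)
    also have "\<dots> = (LINT x|lborel. \<phi> x * f x) - k * (LINT x|lborel. \<eta> x * f x)"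
      using integrable_test_mult[OF \<phi> f] integrable_test_mult[OF \<eta>(1) f] by simp
    also have "k * (LINT x|lborel. \<eta> x * f x) = C * (LINT x|lborel. \<phi> x)"
      by (simp add: k_def C_def)
    finally show ?thesis
      using integrable_test_mult[OF \<phi> f] int1[OF \<phi>] by (simp add: right_diff_distrib)
  qed
  then have "AE x in lborel. f x - C = 0"
    by (intro AE_zero_if_all_integrals_zero set_integral_zero_if_test_integrals_zero fC)
  then show ?thesis by auto
qed

text \<open>\<open>f\<close> and a primitive of \<open>g\<close> have the same weak derivative, so
  they differ by a constant, which is absorbed into the primitive.\<close>

lemma ex_primitive_AE_eq:
  fixes f g :: "real \<Rightarrow> real"
  assumes "has_weak_deriv f g"
  shows "\<exists>F. is_primitive F g \<and> (AE x in lborel. f x = F x)"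
proof -
  have f: "f \<in> L1_loc" and g: "g \<in> L1_loc"
    and weak: "\<And>\<phi> :: real \<Rightarrow> real. \<phi> \<in> test_functions \<Longrightarrow>
      (LINT x|lborel. vderiv \<phi> x * f x) = - (LINT x|lborel. \<phi> x * g x)"
    using assms by (auto simp: has_weak_deriv_def)
  obtain F where F: "is_primitive F g" using ex_primitive[OF g] by blast
  have FL: "F \<in> L1_loc" by (rule continuous_imp_L1_loc[OF is_primitive_continuous[OF F]])
  have "\<exists>C. AE x in lborel. f x - F x = C"
  proof (rule du_Bois_Reymond)
    show "(\<lambda>x. f x - F x) \<in> L1_loc" by (rule L1_loc_diff[OF f FL])
    fix \<phi> :: "real \<Rightarrow> real" assume \<phi>: "\<phi> \<in> test_functions"
    show "(LINT x|lborel. vderiv \<phi> x * (f x - F x)) = 0"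
      using weak[OF \<phi>] is_primitive_weak[OF F \<phi>]
        integrable_test_mult[OF test_functions_vderiv[OF \<phi>] f] integrable_test_mult[OF test_functions_vderiv[OF \<phi>] FL]
      by (simp add: right_diff_distrib)
  qed
  then obtain C where "AE x in lborel. f x - F x = C" by blast
  then have "AE x in lborel. f x = F x + C" by eventually_elim simp
  moreover have "is_primitive (\<lambda>x. F x + C) g"
    using is_primitive_add[OF F is_primitive_const[of C]] by simp
  ultimately show ?thesis by blast
qed

lemma continuous_AE_eq_imp_eq:
  fixes F G :: "real \<Rightarrow> real"
  assumes F: "continuous_on UNIV F" and G: "continuous_on UNIV G" and "open S"
    and AE: "AE x in lborel. x \<in> S \<longrightarrow> F x = G x" and "x \<in> S"
  shows "F x = G x"
proof (rule ccontr)
  assume "F x \<noteq> G x"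
  have "open (S \<inter> {x. F x \<noteq> G x})"
    using F G \<open>open S\<close> by (intro open_Int open_Collect_neq)
  then obtain e where e: "e > 0" "cball x e \<subseteq> S \<inter> {x. F x \<noteq> G x}"
    using \<open>x \<in> S\<close> \<open>F x \<noteq> G x\<close> open_contains_cball[of "S \<inter> {x. F x \<noteq> G x}"] by blast
  have "AE t in lborel. t \<notin> {x - e..x + e}" using AE
  proof eventually_elim
    case (elim t)
    then show ?case using e(2) unfolding cball_eq_atLeastAtMost by blast
  qed
  then have "emeasure lborel {x - e..x + e} = 0"
    by (subst (asm) AE_iff_measurable[of "{x - e..x + e}"]) auto
  then show False using e(1) by simp
qed

text \<open>This is how an identity valid on an interval gets differentiated: move everything to one
  side and read off that the density of the resulting primitive vanishes.\<close>

lemma is_primitive_const_imp_AE_zero: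
  assumes F: "is_primitive F f" and AE: "AE x in lborel. x \<in> {a<..<b} \<longrightarrow> F x = C"
  shows "AE x in lborel. x \<in> {a<..<b} \<longrightarrow> f x = 0"
proof (rule AE_zero_if_integrals_zero_local[OF is_primitiveD(2)[OF F]])
  have "F x = C" if "x \<in> {a<..<b}" for x
    by (rule continuous_AE_eq_imp_eq[OF is_primitive_continuous[OF F] _ _ AE that]) auto
  then show "(LINT t:{x..y}|lborel. f t) = 0" if "a < x" "x \<le> y" "y < b" for x y
    using is_primitiveD(1)[OF F, of x y] that by simp
qed

lemma is_primitive_AE_zero_imp_const:
  assumes F: "is_primitive F f" and AE: "AE x in lborel. f x = 0"
  shows "F x = F 0"
proof -
  have "F x = F y" if "x \<le> y" for x y
  proof -
    have "(LINT t:{x..y}|lborel. f t) = 0"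
      unfolding set_lebesgue_integral_def
      by (rule integral_eq_zero_AE) (use AE in auto)
    then show ?thesis using is_primitiveD(1)[OF F that] by simp
  qed
  then show ?thesis by (metis linear)
qed

lemma has_weak_deriv_continuous_is_primitive:
  fixes f g :: "real \<Rightarrow> real"
  assumes "has_weak_deriv f g" "continuous_on UNIV f"
  shows "is_primitive f g"
proof -
  obtain F where F: "is_primitive F g" and AE: "AE x in lborel. f x = F x"
    using ex_primitive_AE_eq[OF assms(1)] by blast
  have "f x = F x" for x
    by (rule continuous_AE_eq_imp_eq[OF assms(2) is_primitive_continuous[OF F], of UNIV]) (use AE in auto)
  then have "f = F" by auto
  with F show ?thesis by simp
qed

text \<open>Needed because \<open>weak_deriv\<close> is an arbitrary choice: it lets any explicitly
  computed weak derivative stand in for the chosen one.\<close>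

lemma has_weak_deriv_AE_unique:
  fixes f g h :: "real \<Rightarrow> real"
  assumes "has_weak_deriv f g" "has_weak_deriv f h" "continuous_on UNIV f"
  shows "AE x in lborel. g x = h x"
proof -
  have "is_primitive (\<lambda>x. f x + (-1) * f x) (\<lambda>x. g x + (-1) * h x)"
    using assms by (intro is_primitive_add is_primitive_cmult has_weak_deriv_continuous_is_primitive)
  then have P: "is_primitive (\<lambda>x. 0) (\<lambda>x. g x - h x)" by simp
  have "AE x in lborel. g x - h x = 0"
    by (rule AE_zero_if_all_integrals_zero[OF is_primitiveD(2)[OF P]])
       (use is_primitiveD(1)[OF P] in simp)
  then show ?thesis by simp
qed

lemma is_primitive_has_weak_deriv:
  "is_primitive F f \<Longrightarrow> has_weak_deriv F f"
  unfolding has_weak_deriv_def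
  by (simp add: is_primitive_weak is_primitiveD(2) continuous_imp_L1_loc is_primitive_continuous)

section \<open>Reduction of vector-valued weak derivatives to real components\<close>

lemma L1_loc_inner:
  fixes f :: "real \<Rightarrow> 'a::{real_inner, banach, second_countable_topology}"
  assumes "f \<in> L1_loc"
  shows "(\<lambda>x. f x \<bullet> z) \<in> L1_loc"
  using assms unfolding L1_loc_def set_integrable_def mem_Collect_eq
proof (intro allI impI)
  fix K :: "real set" assume "\<forall>K. compact K \<longrightarrow> integrable lborel (\<lambda>x. indicat_real K x *\<^sub>R f x)" "compact K"
  then have "integrable lborel (\<lambda>x. (indicat_real K x *\<^sub>R f x) \<bullet> z)"
    by (intro integrable_inner_left) blast
  then show "integrable lborel (\<lambda>x. indicat_real K x *\<^sub>R (f x \<bullet> z))" by simp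
qed

lemma has_weak_deriv_inner:
  fixes f g :: "real \<Rightarrow> 'a::{real_inner, banach, second_countable_topology}"
  assumes "has_weak_deriv f g"
  shows "has_weak_deriv (\<lambda>x. f x \<bullet> z) (\<lambda>x. g x \<bullet> z)"
  unfolding has_weak_deriv_def
proof (intro conjI allI impI)
  have f: "f \<in> L1_loc" and g: "g \<in> L1_loc"
    using assms by (auto simp: has_weak_deriv_def)
  show "(\<lambda>x. f x \<bullet> z) \<in> L1_loc" "(\<lambda>x. g x \<bullet> z) \<in> L1_loc"
    by (intro L1_loc_inner f g)+
  fix \<phi> :: "real \<Rightarrow> real" assume \<phi>: "\<phi> \<in> test_functions"
  have "(LINT x|lborel. vderiv \<phi> x *\<^sub>R f x) \<bullet> z = - (LINT x|lborel. \<phi> x *\<^sub>R g x) \<bullet> z"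
    using assms \<phi> by (simp add: has_weak_deriv_def)
  then show "(LINT x|lborel. vderiv \<phi> x *\<^sub>R (f x \<bullet> z)) = - (LINT x|lborel. \<phi> x *\<^sub>R (g x \<bullet> z))"
    using integral_inner_left[OF integrable_test_scaleR[OF test_functions_vderiv[OF \<phi>] f], of z]
      integral_inner_left[OF integrable_test_scaleR[OF \<phi> g], of z]
    by simp
qed


section \<open>Travelling waves\<close>

text \<open>Exchanging integrands almost everywhere requires measurability of the representative
  picked by \<open>weak_deriv\<close>; it is the pointwise limit of its truncations to growing
  intervals.\<close>

lemma L1_loc_borel_measurable:
  assumes "f \<in> L1_loc"
  shows "f \<in> borel_measurable lborel"
proof (rule borel_measurable_LIMSEQ_metric)
  show "(\<lambda>x. indicator {- real n..real n} x *\<^sub>R f x) \<in> borel_measurable lborel" for n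
    using L1_loc_set_integrable[OF assms, of "- real n" "real n"]
    unfolding set_integrable_def by (rule borel_measurable_integrable)
  fix x
  obtain N where N: "\<bar>x\<bar> \<le> real N" using real_arch_simple by blast
  show "(\<lambda>n. indicator {- real n..real n} x *\<^sub>R f x) \<longlonglongrightarrow> f x"
  proof (rule tendsto_eventually, rule eventually_sequentiallyI[of N])
    fix n assume "N \<le> n"
    then have "real N \<le> real n" by simp
    then have "- real n \<le> x" "x \<le> real n" using N by linarith+
    then show "indicator {- real n..real n} x *\<^sub>R f x = f x" by simp
  qed
qed

text \<open>Controls the term of \<open>TW_source\<close> that is quadratic in u'; this is where
  finiteness of the energy of u' is first used.\<close>

lemma L2_inner_mult_inner_integrable:
  fixes f :: "real \<Rightarrow> 'a::euclidean_space"
  assumes "f \<in> L2"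
  shows "integrable lborel (\<lambda>x. (f x \<bullet> a) * (f x \<bullet> b))"
proof (rule Bochner_Integration.integrable_bound)
  have [measurable]: "f \<in> borel_measurable lborel" and int: "integrable lborel (\<lambda>x. (norm (f x))\<^sup>2)"
    using assms by (simp_all add: L2_def)
  show "integrable lborel (\<lambda>x. norm a * norm b * (norm (f x))\<^sup>2)"
    using int by simp
  show "(\<lambda>x. (f x \<bullet> a) * (f x \<bullet> b)) \<in> borel_measurable lborel"
    by measurable
  have "\<bar>f x \<bullet> a\<bar> * \<bar>f x \<bullet> b\<bar> \<le> (norm (f x) * norm a) * (norm (f x) * norm b)" for x
    by (intro mult_mono Cauchy_Schwarz_ineq2) auto
  then show "AE x in lborel. norm ((f x \<bullet> a) * (f x \<bullet> b)) \<le> norm (norm a * norm b * (norm (f x))\<^sup>2)"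
    by (intro AE_I2) (simp add: abs_mult power2_eq_square mult_ac)
qed

lemma AE_interval_ex:
  fixes a b :: real
  assumes "a < b" and AE: "AE x in lborel. x \<in> {a<..<b} \<longrightarrow> P x"
  shows "\<exists>x\<in>{a<..<b}. P x"
proof (rule ccontr)
  assume *: "\<not> (\<exists>x\<in>{a<..<b}. P x)"
  have "AE x in lborel. x \<notin> {a<..<b}"
    using AE by eventually_elim (use * in blast)
  then have "emeasure lborel {a<..<b} = 0"
    by (subst (asm) AE_iff_measurable[of "{a<..<b}"]) auto
  then show False using \<open>a < b\<close> by simp
qed

lemma integrable_lborel_const_imp_zero:
  assumes "integrable lborel (\<lambda>x::real. k::real)"
  shows "k = 0"
proof (rule ccontr)
  assume "k \<noteq> 0"
  then have "(\<integral>\<^sup>+ x. ennreal (norm k) \<partial>(lborel :: real measure)) = \<infinity>"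
    by (simp add: nn_integral_const ennreal_mult_top)
  then show False
    using assms by (simp add: integrable_iff_bounded)
qed

section \<open>The equation in divergence form\<close>

definition TW_flux :: "real \<Rightarrow> (real \<Rightarrow> complex) \<Rightarrow> real \<Rightarrow> complex" where
  "TW_flux \<kappa> u x = weak_deriv u x - (2 * \<kappa> * (u x \<bullet> weak_deriv u x)) *\<^sub>R u x"

text \<open>Flux and source arise by expanding \<langle>u, \<phi>\<rangle>' = \<langle>u',
  \<phi>\<rangle> + \<langle>u, \<phi>'\<rangle> in the weak formulation and sorting by \<phi> and
  \<phi>': what is paired with \<phi>' is minus the flux, what is paired with \<phi> is the source.
  The equation becomes: (flux)' = - source.\<close>

definition TW_source :: "real \<Rightarrow> real \<Rightarrow> (real \<Rightarrow> complex) \<Rightarrow> real \<Rightarrow> complex" where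
  "TW_source c \<kappa> u x = \<i> * of_real c * weak_deriv u x + u x * of_real (1 - (cmod (u x))\<^sup>2)
     + (2 * \<kappa> * (u x \<bullet> weak_deriv u x)) *\<^sub>R weak_deriv u x"

lemma energy_space_has_weak_deriv:
  assumes "u \<in> energy_space"
  shows "has_weak_deriv u (weak_deriv u)"
proof -
  obtain g where "has_weak_deriv u g"
    using assms by (auto simp: energy_space_def H1_loc_def)
  then show ?thesis
    unfolding weak_deriv_def by (rule someI[of "has_weak_deriv u"])
qed

lemma energy_space_is_primitive:
  assumes "u \<in> energy_space"
  shows "is_primitive (\<lambda>x. u x \<bullet> z) (\<lambda>x. weak_deriv u x \<bullet> z)"
proof (rule has_weak_deriv_continuous_is_primitive)
  show "has_weak_deriv (\<lambda>x. u x \<bullet> z) (\<lambda>x. weak_deriv u x \<bullet> z)"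
    by (rule has_weak_deriv_inner[OF energy_space_has_weak_deriv[OF assms]])
  show "continuous_on UNIV (\<lambda>x. u x \<bullet> z)"
    by (intro continuous_intros) (use assms in \<open>simp add: energy_space_def\<close>)
qed

lemma inner_complex_components: "z \<bullet> w = Re z * Re w + Im z * Im w"
  by (simp add: inner_complex_def)

lemma TW_flux_L1_loc:
  assumes u: "u \<in> energy_space"
  shows "(\<lambda>x. TW_flux \<kappa> u x \<bullet> z) \<in> L1_loc"
proof -
  let ?g = "weak_deriv u"
  have g: "(\<lambda>x. ?g x \<bullet> w) \<in> L1_loc" for w
    by (rule is_primitiveD(2)[OF energy_space_is_primitive[OF u]])
  have cu: "continuous_on UNIV u"
    using u by (simp add: energy_space_def)
  \<comment> \<open>Splitting \<langle>u, u'\<rangle> along 1 and \<i> makes every summand a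
    continuous function times a component of u'.\<close>
  have "(\<lambda>x. ?g x \<bullet> z - (2 * \<kappa> * (u x \<bullet> 1) * (u x \<bullet> z) * (?g x \<bullet> 1)
      + 2 * \<kappa> * (u x \<bullet> \<i>) * (u x \<bullet> z) * (?g x \<bullet> \<i>))) \<in> L1_loc"
    by (intro L1_loc_diff L1_loc_add L1_loc_continuous_mult g continuous_intros cu)
  also have "(\<lambda>x. ?g x \<bullet> z - (2 * \<kappa> * (u x \<bullet> 1) * (u x \<bullet> z) * (?g x \<bullet> 1)
      + 2 * \<kappa> * (u x \<bullet> \<i>) * (u x \<bullet> z) * (?g x \<bullet> \<i>))) = (\<lambda>x. TW_flux \<kappa> u x \<bullet> z)"
    by (simp add: TW_flux_def fun_eq_iff inner_diff_left inner_complex_components[of "u _" "weak_deriv u _"] algebra_simps)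
  finally show ?thesis .
qed

lemma TW_source_L1_loc:
  assumes u: "u \<in> energy_space"
  shows "(\<lambda>x. TW_source c \<kappa> u x \<bullet> z) \<in> L1_loc"
proof -
  let ?g = "weak_deriv u"
  have g: "(\<lambda>x. ?g x \<bullet> w) \<in> L1_loc" for w
    by (rule is_primitiveD(2)[OF energy_space_is_primitive[OF u]])
  have cu: "continuous_on UNIV u" and "?g \<in> L2"
    using u by (simp_all add: energy_space_def)
  then have gg: "(\<lambda>x. (?g x \<bullet> w) * (?g x \<bullet> z)) \<in> L1_loc" for w
    by (intro integrable_imp_L1_loc L2_inner_mult_inner_integrable)
  \<comment> \<open>Multiplication by \<i> is moved to its adjoint -\<i> acting on z, and
    \<langle>u, u'\<rangle> is split along 1 and \<i> so that only products of two components of u'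
    with continuous weights remain.\<close>
  have "(\<lambda>x. (c * (?g x \<bullet> (- \<i> * z)) + (1 - (cmod (u x))\<^sup>2) * (u x \<bullet> z))
      + (2 * \<kappa> * (u x \<bullet> 1) * ((?g x \<bullet> 1) * (?g x \<bullet> z))
      + 2 * \<kappa> * (u x \<bullet> \<i>) * ((?g x \<bullet> \<i>) * (?g x \<bullet> z)))) \<in> L1_loc"
    by (intro L1_loc_add L1_loc_continuous_mult[OF gg] L1_loc_cmult g continuous_imp_L1_loc continuous_intros cu)
  also have "(\<lambda>x. (c * (?g x \<bullet> (- \<i> * z)) + (1 - (cmod (u x))\<^sup>2) * (u x \<bullet> z))
      + (2 * \<kappa> * (u x \<bullet> 1) * ((?g x \<bullet> 1) * (?g x \<bullet> z))
      + 2 * \<kappa> * (u x \<bullet> \<i>) * ((?g x \<bullet> \<i>) * (?g x \<bullet> z)))) = (\<lambda>x. TW_source c \<kappa> u x \<bullet> z)"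
    by (simp add: TW_source_def fun_eq_iff inner_complex_components algebra_simps)
  finally show ?thesis .
qed

lemma weak_deriv_inner_test_function:
  fixes \<phi> :: "real \<Rightarrow> real" and z :: complex
  assumes u: "u \<in> energy_space" and \<phi>: "\<phi> \<in> test_functions"
  defines "F \<equiv> \<lambda>y. u y \<bullet> (\<phi> y *\<^sub>R z)"
  shows "weak_deriv F \<in> borel_measurable lborel"
    and "AE x in lborel. weak_deriv F x = vderiv \<phi> x * (u x \<bullet> z) + \<phi> x * (weak_deriv u x \<bullet> z)"
proof -
  have F: "F = (\<lambda>y. \<phi> y * (u y \<bullet> z))"
    by (simp add: F_def)
  have P: "is_primitive F (\<lambda>x. vderiv \<phi> x * (u x \<bullet> z) + \<phi> x * (weak_deriv u x \<bullet> z))"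
    unfolding F by (rule is_primitive_mult[OF test_function_is_primitive[OF \<phi>] energy_space_is_primitive[OF u]])
  note P' = is_primitive_has_weak_deriv[OF P]
  have W: "has_weak_deriv F (weak_deriv F)"
    unfolding weak_deriv_def[of F] by (rule someI[of "has_weak_deriv F", OF P'])
  then show "weak_deriv F \<in> borel_measurable lborel"
    unfolding has_weak_deriv_def by (intro L1_loc_borel_measurable) blast
  show "AE x in lborel. weak_deriv F x = vderiv \<phi> x * (u x \<bullet> z) + \<phi> x * (weak_deriv u x \<bullet> z)"
    by (rule has_weak_deriv_AE_unique[OF W P' is_primitive_continuous[OF P]])
qed

text \<open>Test functions of the form \<phi> z, with \<phi> real and z a fixed direction, already
  capture the equation, one real component at a time.\<close>

lemma TW_flux_has_weak_deriv:
  assumes sol: "weak_solution_TW c \<kappa> u"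
  shows "has_weak_deriv (\<lambda>x. TW_flux \<kappa> u x \<bullet> z) (\<lambda>x. (-1) * (TW_source c \<kappa> u x \<bullet> z))"
  unfolding has_weak_deriv_def
proof (intro conjI allI impI)
  have u: "u \<in> energy_space"
    using sol by (simp add: weak_solution_TW_def)
  note flux = TW_flux_L1_loc[OF u, of \<kappa> z] and source = TW_source_L1_loc[OF u, of c \<kappa> z]
  show "(\<lambda>x. TW_flux \<kappa> u x \<bullet> z) \<in> L1_loc" by (rule flux)
  show "(\<lambda>x. (-1) * (TW_source c \<kappa> u x \<bullet> z)) \<in> L1_loc" by (rule L1_loc_cmult[OF source])
  fix \<phi> :: "real \<Rightarrow> real" assume \<phi>: "\<phi> \<in> test_functions"
  have d: "vderiv (\<lambda>x. \<phi> x *\<^sub>R z) = (\<lambda>x. vderiv \<phi> x *\<^sub>R z)"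
    by (rule vderiv_eqI[OF has_vector_derivative_vderiv_scaleR[OF test_functions_differentiable[OF \<phi>]]])
  have [measurable]: "u \<in> borel_measurable lborel" "weak_deriv u \<in> borel_measurable lborel"
    "\<phi> \<in> borel_measurable lborel" "vderiv \<phi> \<in> borel_measurable lborel"
    using u test_functions_continuous[OF \<phi>] test_functions_continuous[OF test_functions_vderiv[OF \<phi>]]
    by (simp_all add: energy_space_def L2_def borel_measurable_continuous_onI)
  note W = weak_deriv_inner_test_function[OF u \<phi>, of z]
  note W(1)[measurable]
  note ints = integrable_test_mult[OF \<phi> source] integrable_test_mult[OF test_functions_vderiv[OF \<phi>] flux]
  have "0 = (LINT x|lborel.
            (\<i> * of_real c * weak_deriv u x + u x * of_real (1 - (cmod (u x))\<^sup>2)) \<bullet> (\<phi> x *\<^sub>R z)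
          - weak_deriv u x \<bullet> (vderiv \<phi> x *\<^sub>R z)
          + 2 * \<kappa> * (u x \<bullet> weak_deriv u x) * weak_deriv (\<lambda>y. u y \<bullet> (\<phi> y *\<^sub>R z)) x)"
    using sol[unfolded weak_solution_TW_def, THEN conjunct2, rule_format, OF test_functions_scaleR_left[OF \<phi>, of z]]
    unfolding d by (rule sym)
  also have "\<dots> = (LINT x|lborel. \<phi> x * (TW_source c \<kappa> u x \<bullet> z) - vderiv \<phi> x * (TW_flux \<kappa> u x \<bullet> z))"
  proof (rule integral_cong_AE)
    show "AE x in lborel. (\<i> * of_real c * weak_deriv u x + u x * of_real (1 - (cmod (u x))\<^sup>2)) \<bullet> (\<phi> x *\<^sub>R z)
          - weak_deriv u x \<bullet> (vderiv \<phi> x *\<^sub>R z)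
          + 2 * \<kappa> * (u x \<bullet> weak_deriv u x) * weak_deriv (\<lambda>y. u y \<bullet> (\<phi> y *\<^sub>R z)) x
        = \<phi> x * (TW_source c \<kappa> u x \<bullet> z) - vderiv \<phi> x * (TW_flux \<kappa> u x \<bullet> z)"
      using W(2)
    proof eventually_elim
      case (elim x)
      show ?case
        unfolding elim TW_source_def TW_flux_def
        by (simp add: inner_add_left inner_diff_left algebra_simps)
    qed
    show "(\<lambda>x. (\<i> * of_real c * weak_deriv u x + u x * of_real (1 - (cmod (u x))\<^sup>2)) \<bullet> (\<phi> x *\<^sub>R z)
          - weak_deriv u x \<bullet> (vderiv \<phi> x *\<^sub>R z)
          + 2 * \<kappa> * (u x \<bullet> weak_deriv u x) * weak_deriv (\<lambda>y. u y \<bullet> (\<phi> y *\<^sub>R z)) x) \<in> borel_measurable lborel"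
      by measurable
    show "(\<lambda>x. \<phi> x * (TW_source c \<kappa> u x \<bullet> z) - vderiv \<phi> x * (TW_flux \<kappa> u x \<bullet> z)) \<in> borel_measurable lborel"
      by (intro borel_measurable_diff borel_measurable_integrable ints)
  qed
  also have "\<dots> = (LINT x|lborel. \<phi> x * (TW_source c \<kappa> u x \<bullet> z)) - (LINT x|lborel. vderiv \<phi> x * (TW_flux \<kappa> u x \<bullet> z))"
    by (rule Bochner_Integration.integral_diff[OF ints])
  finally show "(LINT x|lborel. vderiv \<phi> x *\<^sub>R (TW_flux \<kappa> u x \<bullet> z)) =
      - (LINT x|lborel. \<phi> x *\<^sub>R ((-1) * (TW_source c \<kappa> u x \<bullet> z)))"
    by simp
qed

text \<open>Pairing the equation with \<open>\<i> u\<close> annihilates the quasilinear term and leaves a total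
  derivative; the constant of integration vanishes because the energy is finite.\<close>

lemma TW_momentum:
  assumes sol: "weak_solution_TW c \<kappa> u"
  shows "AE x in lborel. Re (u x) * Im (weak_deriv u x) - Im (u x) * Re (weak_deriv u x)
    = c / 2 * (1 - (cmod (u x))\<^sup>2)"
proof -
  let ?g = "weak_deriv u" and ?w = "TW_flux \<kappa> u" and ?h = "TW_source c \<kappa> u"
  have u: "u \<in> energy_space"
    using sol by (simp add: weak_solution_TW_def)
  have u1: "is_primitive (\<lambda>x. Re (u x)) (\<lambda>x. Re (?g x))" and u2: "is_primitive (\<lambda>x. Im (u x)) (\<lambda>x. Im (?g x))"
    using energy_space_is_primitive[OF u, of 1] energy_space_is_primitive[OF u, of \<i>] by simp_all
  obtain W1 where W1: "is_primitive W1 (\<lambda>x. (-1) * (?h x \<bullet> 1))" "AE x in lborel. ?w x \<bullet> 1 = W1 x"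
    using ex_primitive_AE_eq[OF TW_flux_has_weak_deriv[OF sol, of 1]] by blast
  obtain W2 where W2: "is_primitive W2 (\<lambda>x. (-1) * (?h x \<bullet> \<i>))" "AE x in lborel. ?w x \<bullet> \<i> = W2 x"
    using ex_primitive_AE_eq[OF TW_flux_has_weak_deriv[OF sol, of \<i>]] by blast
  \<comment> \<open>\<open>R\<close> is \<langle>w, \<i> u\<rangle> + c |u|^2 / 2, with w replaced
    by its continuous representative (\<open>W1\<close>, \<open>W2\<close>).\<close>
  define R where "R = (\<lambda>x. (W2 x * Re (u x) + (-1) * (W1 x * Im (u x)))
      + c / 2 * (Re (u x) * Re (u x) + Im (u x) * Im (u x)))"
  define r where "r = (\<lambda>x. ((-1) * (?h x \<bullet> \<i>) * Re (u x) + W2 x * Re (?g x)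
        + (-1) * ((-1) * (?h x \<bullet> 1) * Im (u x) + W1 x * Im (?g x)))
      + c / 2 * ((Re (?g x) * Re (u x) + Re (u x) * Re (?g x)) + (Im (?g x) * Im (u x) + Im (u x) * Im (?g x))))"
  have R: "is_primitive R r"
    unfolding R_def r_def by (intro is_primitive_add is_primitive_cmult is_primitive_mult W1(1) W2(1) u1 u2)
  \<comment> \<open>Besides the c-terms, the source contributes - 2 \<kappa> \<langle>u, u'\<rangle>
    \<langle>u', \<i> u\<rangle>, and the flux paired with \<i> u' contributes the opposite; the
    cubic-potential term is orthogonal to \<i> u.\<close>
  have "AE x in lborel. r x = 0"
    using W1(2) W2(2)
  proof eventually_elim
    case (elim x)
    show ?case
      unfolding r_def elim[symmetric]
      by (simp add: TW_flux_def TW_source_def inner_complex_components algebra_simps power2_eq_square)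
  qed
  then have const: "R x = R 0" for x
    by (rule is_primitive_AE_zero_imp_const[OF R])
  \<comment> \<open>Shifting by c/2 trades |u|^2 for 1 - |u|^2, the square-integrable quantity;
    \<open>K\<close> is the momentum where |u| = 1.\<close>
  define K where "K = R 0 - c / 2"
  have K: "AE x in lborel. Re (u x) * Im (?g x) - Im (u x) * Re (?g x)
      = K + c / 2 * (1 - (cmod (u x))\<^sup>2)"
    using W1(2) W2(2)
  proof eventually_elim
    case (elim x)
    have "R x = Re (u x) * Im (?g x) - Im (u x) * Re (?g x) + c / 2 * (cmod (u x))\<^sup>2"
      unfolding R_def elim[symmetric] cmod_power2
      by (simp add: TW_flux_def algebra_simps power2_eq_square)
    then show ?case
      using const[of x] by (simp add: K_def algebra_simps)
  qed
  have "integrable lborel (\<lambda>x::real. K\<^sup>2)"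
  proof (rule Bochner_Integration.integrable_bound)
    \<comment> \<open>Where |\<eta>| \<le> 1, |u|^2 \<le> 2 and K = p - c \<eta> / 2 give K^2 \<le>
      2 p^2 + c^2 \<eta>^2 / 2 with p^2 \<le> 2 |u'|^2. Where |\<eta>| > 1, trivially K^2 \<le> K^2
      \<eta>^2. The majorant adds both bounds.\<close>
    let ?b = "\<lambda>x. 4 * (cmod (?g x))\<^sup>2 + (c\<^sup>2 / 2 + K\<^sup>2) * (norm (1 - (cmod (u x))\<^sup>2))\<^sup>2"
    show "integrable lborel ?b"
      using u by (intro Bochner_Integration.integrable_add integrable_mult_right) (simp_all add: energy_space_def L2_def)
    show "AE x in lborel. norm (K\<^sup>2) \<le> norm (?b x)"
      using K
    proof eventually_elim
      case (elim x)
      define \<eta> where "\<eta> = 1 - (cmod (u x))\<^sup>2"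
      define p where "p = Re (u x) * Im (?g x) - Im (u x) * Re (?g x)"
      have "p\<^sup>2 \<le> (cmod (u x))\<^sup>2 * (cmod (?g x))\<^sup>2"
      proof -
        \<comment> \<open>Lagrange's identity.\<close>
        have "(cmod (u x))\<^sup>2 * (cmod (?g x))\<^sup>2 - p\<^sup>2 = (Re (u x) * Re (?g x) + Im (u x) * Im (?g x))\<^sup>2"
          unfolding p_def cmod_power2 by (simp add: power2_eq_square algebra_simps)
        then show ?thesis
          using zero_le_power2[of "Re (u x) * Re (?g x) + Im (u x) * Im (?g x)"] by linarith
      qed
      then have p: "p\<^sup>2 \<le> (1 - \<eta>) * (cmod (?g x))\<^sup>2" by (simp add: \<eta>_def)
      have "K\<^sup>2 \<le> 4 * (cmod (?g x))\<^sup>2 + (c\<^sup>2 / 2 + K\<^sup>2) * \<eta>\<^sup>2"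
      proof (cases "\<bar>\<eta>\<bar> \<le> 1")
        case True
        have K_eq: "K = p - c / 2 * \<eta>" using elim unfolding p_def \<eta>_def by linarith
        have "2 * p\<^sup>2 + c\<^sup>2 / 2 * \<eta>\<^sup>2 - K\<^sup>2 = (p + c / 2 * \<eta>)\<^sup>2"
          unfolding K_eq by (simp add: power2_eq_square algebra_simps)
        then have "K\<^sup>2 \<le> 2 * p\<^sup>2 + c\<^sup>2 / 2 * \<eta>\<^sup>2"
          using zero_le_power2[of "p + c / 2 * \<eta>"] by linarith
        moreover have "(1 - \<eta>) * (cmod (?g x))\<^sup>2 \<le> 2 * (cmod (?g x))\<^sup>2"
          using True by (intro mult_right_mono) auto
        moreover have "0 \<le> K\<^sup>2 * \<eta>\<^sup>2" by simp
        ultimately show ?thesis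
          using p unfolding distrib_right by linarith
      next
        case False
        then have "1 \<le> \<eta>\<^sup>2"
          using abs_le_square_iff[of 1 \<eta>] by simp
        then have "K\<^sup>2 * 1 \<le> K\<^sup>2 * \<eta>\<^sup>2"
          by (rule mult_left_mono) simp
        moreover have "0 \<le> c\<^sup>2 / 2 * \<eta>\<^sup>2" "0 \<le> 4 * (cmod (?g x))\<^sup>2" by simp_all
        ultimately show ?thesis
          unfolding distrib_right by linarith
      qed
      then show ?case by (simp add: \<eta>_def)
    qed
  qed simp
  then have "K\<^sup>2 = 0"
    by (rule integrable_lborel_const_imp_zero)
  with K show ?thesis by simp
qed

text \<open>Constant modulus means \<langle>u, u'\<rangle> = 0, which removes every term carrying
  \<kappa>, so the conclusion is free of it. \<beta> is the angular velocity: the momentum identity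
  reads \<rho> \<beta> = c (1 - \<rho>) / 2.\<close>

lemma TW_constant_modulus:
  assumes sol: "weak_solution_TW c \<kappa> u" and "a < b" and "\<rho> > 0"
    and mod: "\<And>x. x \<in> {a<..<b} \<Longrightarrow> (cmod (u x))\<^sup>2 = \<rho>"
  defines "\<beta> \<equiv> c * (1 - \<rho>) / (2 * \<rho>)"
  shows "c * \<beta> + \<beta>\<^sup>2 = 1 - \<rho>"
proof -
  let ?g = "weak_deriv u" and ?w = "TW_flux \<kappa> u" and ?h = "TW_source c \<kappa> u"
  have u: "u \<in> energy_space"
    using sol by (simp add: weak_solution_TW_def)
  have u1: "is_primitive (\<lambda>x. Re (u x)) (\<lambda>x. Re (?g x))" and u2: "is_primitive (\<lambda>x. Im (u x)) (\<lambda>x. Im (?g x))"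
    using energy_space_is_primitive[OF u, of 1] energy_space_is_primitive[OF u, of \<i>] by simp_all
  obtain W1 where W1: "is_primitive W1 (\<lambda>x. (-1) * (?h x \<bullet> 1))" "AE x in lborel. ?w x \<bullet> 1 = W1 x"
    using ex_primitive_AE_eq[OF TW_flux_has_weak_deriv[OF sol, of 1]] by blast
  obtain W2 where W2: "is_primitive W2 (\<lambda>x. (-1) * (?h x \<bullet> \<i>))" "AE x in lborel. ?w x \<bullet> \<i> = W2 x"
    using ex_primitive_AE_eq[OF TW_flux_has_weak_deriv[OF sol, of \<i>]] by blast
  have sq: "Re (u x) * Re (u x) + Im (u x) * Im (u x) = \<rho>" if "x \<in> {a<..<b}" for x
    using mod[OF that] unfolding cmod_power2 by (simp add: power2_eq_square)
  have "AE x in lborel. x \<in> {a<..<b} \<longrightarrow>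
      (Re (?g x) * Re (u x) + Re (u x) * Re (?g x)) + (Im (?g x) * Im (u x) + Im (u x) * Im (?g x)) = 0"
    by (rule is_primitive_const_imp_AE_zero[where C = \<rho>, OF is_primitive_add[OF is_primitive_mult[OF u1 u1] is_primitive_mult[OF u2 u2]]])
       (intro AE_I2 impI sq)
  then have g: "AE x in lborel. x \<in> {a<..<b} \<longrightarrow>
      u x \<bullet> ?g x = 0 \<and> Re (?g x) = - \<beta> * Im (u x) \<and> Im (?g x) = \<beta> * Re (u x)"
    using TW_momentum[OF sol]
  proof eventually_elim
    case (elim x)
    show ?case
    proof
      assume x: "x \<in> {a<..<b}"
      define u1 u2 g1 g2 where defs: "u1 = Re (u x)" "u2 = Im (u x)" "g1 = Re (?g x)" "g2 = Im (?g x)"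
      have s: "u1 * g1 + u2 * g2 = 0"
        using elim(1) x by (simp add: defs mult.commute)
      have m: "u1 * g2 - u2 * g1 = \<rho> * \<beta>"
        using elim(2) mod[OF x] \<open>\<rho> > 0\<close> by (simp add: defs \<beta>_def)
      have r: "u1 * u1 + u2 * u2 = \<rho>"
        using sq[OF x] by (simp add: defs)
      \<comment> \<open>Expansion of u' in the orthogonal frame u, \<i> u, multiplied by |u|^2 to
        avoid a division.\<close>
      have I: "(u1 * u1 + u2 * u2) * g1 = u1 * (u1 * g1 + u2 * g2) - u2 * (u1 * g2 - u2 * g1)"
        "(u1 * u1 + u2 * u2) * g2 = u2 * (u1 * g1 + u2 * g2) + u1 * (u1 * g2 - u2 * g1)"
        by (simp_all add: algebra_simps)
      have "u1 * 0 - u2 * (\<rho> * \<beta>) = \<rho> * (- \<beta> * u2)" "u2 * 0 + u1 * (\<rho> * \<beta>) = \<rho> * (\<beta> * u1)"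
        by simp_all
      then have "\<rho> * g1 = \<rho> * (- \<beta> * u2)" "\<rho> * g2 = \<rho> * (\<beta> * u1)"
        using I unfolding s m r by (simp_all only:)
      moreover have "\<rho> \<noteq> 0" using \<open>\<rho> > 0\<close> by simp
      ultimately have "g1 = - \<beta> * u2" "g2 = \<beta> * u1"
        unfolding mult_cancel_left by blast+
      then show "u x \<bullet> ?g x = 0 \<and> Re (?g x) = - \<beta> * Im (u x) \<and> Im (?g x) = \<beta> * Re (u x)"
        using s by (simp add: defs inner_complex_components)
    qed
  qed
  \<comment> \<open>Here the flux is just u' = \<i> \<beta> u; in real parts this says that a
    combination of primitives vanishes on the interval. Differentiating it replaces the use of
    u''.\<close>
  have "AE x in lborel. x \<in> {a<..<b} \<longrightarrow> W1 x + \<beta> * Im (u x) = 0"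
    using g W1(2)
  proof eventually_elim
    case (elim x)
    show ?case
      using elim(1) unfolding elim(2)[symmetric] by (simp add: TW_flux_def)
  qed
  then have h1: "AE x in lborel. x \<in> {a<..<b} \<longrightarrow> (-1) * (?h x \<bullet> 1) + \<beta> * Im (?g x) = 0"
    by (rule is_primitive_const_imp_AE_zero[OF is_primitive_add[OF W1(1) is_primitive_cmult[OF u2]]])
  have "AE x in lborel. x \<in> {a<..<b} \<longrightarrow> W2 x + (- \<beta>) * Re (u x) = 0"
    using g W2(2)
  proof eventually_elim
    case (elim x)
    show ?case
      using elim(1) unfolding elim(2)[symmetric] by (simp add: TW_flux_def)
  qed
  then have h2: "AE x in lborel. x \<in> {a<..<b} \<longrightarrow> (-1) * (?h x \<bullet> \<i>) + (- \<beta>) * Re (?g x) = 0"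
    by (rule is_primitive_const_imp_AE_zero[OF is_primitive_add[OF W2(1) is_primitive_cmult[OF u1]]])
  \<comment> \<open>Both derivatives of the flux agree: - source = (c \<beta> - (1 - \<rho>)) u and
    \<i> \<beta> u' = - \<beta>^2 u.\<close>
  have "AE x in lborel. x \<in> {a<..<b} \<longrightarrow>
      (c * \<beta> + \<beta>\<^sup>2 - (1 - \<rho>)) * Re (u x) = 0 \<and> (c * \<beta> + \<beta>\<^sup>2 - (1 - \<rho>)) * Im (u x) = 0"
    using g h1 h2
  proof eventually_elim
    case (elim x)
    show ?case
    proof
      assume x: "x \<in> {a<..<b}"
      then have "u x \<bullet> ?g x = 0" and g: "Re (?g x) = - \<beta> * Im (u x)" "Im (?g x) = \<beta> * Re (u x)"
        using elim(1) by blast+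
      then have h: "?h x \<bullet> 1 = - (c * Im (?g x)) + (1 - \<rho>) * Re (u x)"
        "?h x \<bullet> \<i> = c * Re (?g x) + (1 - \<rho>) * Im (u x)"
        unfolding TW_source_def mod[OF x] by simp_all
      have "(-1) * (?h x \<bullet> 1) + \<beta> * Im (?g x) = 0" "(-1) * (?h x \<bullet> \<i>) + (- \<beta>) * Re (?g x) = 0"
        using elim(2,3) x by blast+
      then show "(c * \<beta> + \<beta>\<^sup>2 - (1 - \<rho>)) * Re (u x) = 0 \<and> (c * \<beta> + \<beta>\<^sup>2 - (1 - \<rho>)) * Im (u x) = 0"
        unfolding h g by (simp add: algebra_simps power2_eq_square)
    qed
  qed
  \<comment> \<open>The coefficient is a constant, so one good point suffices, and u does not vanish
    there.\<close>
  from AE_interval_ex[OF \<open>a < b\<close> this]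
  obtain x where x: "x \<in> {a<..<b}"
    and *: "(c * \<beta> + \<beta>\<^sup>2 - (1 - \<rho>)) * Re (u x) = 0" "(c * \<beta> + \<beta>\<^sup>2 - (1 - \<rho>)) * Im (u x) = 0"
    by blast
  have "\<not> (Re (u x) = 0 \<and> Im (u x) = 0)"
    using sq[OF x] \<open>\<rho> > 0\<close> by auto
  then have "c * \<beta> + \<beta>\<^sup>2 - (1 - \<rho>) = 0"
    using * unfolding mult_eq_0_iff by blast
  then show ?thesis by simp
qed

theorem proposition1p7:
  fixes c \<kappa> :: real and u :: "real \<Rightarrow> complex"
  assumes "(c, \<kappa>) \<in> params_D_tilde \<union> params_C"
    and "u \<in> energy_space"
    and "weak_solution_TW c \<kappa> u"
    and "\<exists>a b :: real. a < b \<and> (\<forall>x\<in>{a<..<b}. (cmod (u x))\<^sup>2 = 1 / (2 * \<kappa>))"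
  shows "\<kappa> = 1/2"
proof (rule ccontr)
  assume "\<kappa> \<noteq> 1/2"
  have "\<kappa> > 0" and cases: "0 \<le> c \<and> c \<le> sqrt 2 \<and> \<kappa> < 1/2 \<or> sqrt 2 \<le> c \<and> 1/2 < \<kappa>"
    using assms(1) \<open>\<kappa> \<noteq> 1/2\<close>
    by (auto simp: params_D_tilde_def params_C_def params_D1_def params_D3_def
        params_B_minus_def params_B_plus_def)
  obtain a b where "a < b" "\<And>x. x \<in> {a<..<b} \<Longrightarrow> (cmod (u x))\<^sup>2 = 1 / (2 * \<kappa>)"
    using assms(4) by blast
  from TW_constant_modulus[OF assms(3) \<open>a < b\<close> _ this(2)] \<open>\<kappa> > 0\<close>
  have *: "c * (c * (1 - 1 / (2 * \<kappa>)) / (2 * (1 / (2 * \<kappa>)))) + (c * (1 - 1 / (2 * \<kappa>)) / (2 * (1 / (2 * \<kappa>))))\<^sup>2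
      = 1 - 1 / (2 * \<kappa>)"
    by simp
  have \<beta>: "c * (1 - 1 / (2 * \<kappa>)) / (2 * (1 / (2 * \<kappa>))) = c * (2 * \<kappa> - 1) / 2"
    using \<open>\<kappa> > 0\<close> by (simp add: field_simps)
  have "c * (c * (2 * \<kappa> - 1) / 2) + (c * (2 * \<kappa> - 1) / 2)\<^sup>2 = 1 - 1 / (2 * \<kappa>)"
    using * unfolding \<beta> .
  then have "2 * \<kappa> - 1 = 2 * \<kappa> * (c * (c * (2 * \<kappa> - 1) / 2) + (c * (2 * \<kappa> - 1) / 2)\<^sup>2)"
    using \<open>\<kappa> > 0\<close> by (simp add: field_simps)
  also have "\<dots> = (2 * \<kappa> - 1) * (c\<^sup>2 * (\<kappa> * (2 * \<kappa> + 1))) / 2"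
    by (simp add: power2_eq_square field_simps)
  finally have "(2 * \<kappa> - 1) * (c\<^sup>2 * (\<kappa> * (2 * \<kappa> + 1))) = (2 * \<kappa> - 1) * 2"
    by (simp only: eq_divide_eq_numeral1 if_False zero_neq_numeral mult.commute)
  \<comment> \<open>This cancellation is where \<kappa> \<noteq> 1/2 enters algebraically; for
    \<kappa> = 1/2 both sides vanish.\<close>
  then have eq: "c\<^sup>2 * (\<kappa> * (2 * \<kappa> + 1)) = 2"
    using \<open>\<kappa> \<noteq> 1/2\<close> unfolding mult_cancel_left by linarith
  \<comment> \<open>The increasing function \<kappa> (2 \<kappa> + 1) equals 1 at \<kappa> = 1/2.
    The strict inequality in \<kappa> thus compensates for c being allowed to equal sqrt 2.\<close>
  from cases show False
  proof
    assume "0 \<le> c \<and> c \<le> sqrt 2 \<and> \<kappa> < 1/2"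
    then have "c\<^sup>2 \<le> 2" using power_mono[of c "sqrt 2" 2] by simp
    have "\<kappa> * (2 * \<kappa> + 1) < 1/2 * 2"
      using \<open>0 \<le> c \<and> _\<close> \<open>\<kappa> > 0\<close> by (intro mult_strict_mono) auto
    moreover have "c\<^sup>2 * (\<kappa> * (2 * \<kappa> + 1)) \<le> 2 * (\<kappa> * (2 * \<kappa> + 1))"
      by (rule mult_right_mono[OF \<open>c\<^sup>2 \<le> 2\<close>]) (use \<open>\<kappa> > 0\<close> in simp)
    ultimately show False using eq by linarith
  next
    assume "sqrt 2 \<le> c \<and> 1/2 < \<kappa>"
    then have "2 \<le> c\<^sup>2" using power_mono[of "sqrt 2" c 2] by simp
    have "1/2 * 2 < \<kappa> * (2 * \<kappa> + 1)"
      using \<open>sqrt 2 \<le> c \<and> _\<close> by (intro mult_strict_mono) auto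
    moreover have "2 * (\<kappa> * (2 * \<kappa> + 1)) \<le> c\<^sup>2 * (\<kappa> * (2 * \<kappa> + 1))"
      by (rule mult_right_mono[OF \<open>2 \<le> c\<^sup>2\<close>]) (use \<open>\<kappa> > 0\<close> in simp)
    ultimately show False using eq by linarith
  qed
qed

end
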